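(* Let $u:\mathbb{R}^2\to\mathbb{R}$ be the crack-tip, given in polar coordinates by $u(\rho,\varphi):=\sqrt{2/\pi}\,\rho^{1/2}\cos\frac{\varphi}{2}$ for $\rho>0$, $0<\varphi<2\pi$, let $e_1=(1,0)$, and define for $r>0$ $$F(r,e_1):=\frac{1}{r}\bigg[\int_{B_r(e_1)\setminus J_u}|\nabla u|^2\,dx+\frac12\mathcal{H}^1\big(J_u\cap B_r(e_1)\big)\bigg].$$ Then for every $a>\frac32$ the function $r\mapsto\min\{F(r,e_1),a\}$ is not nondecreasing on $(0,\infty)$. (Consequently, since the crack-tip is a global minimizer of the Mumford-Shah functional, for no $a>\frac32$ is the quantity $\min\{F(r,x_0),a\}$ nondecreasing in $r$ for all minimizers of the Mumford-Shah functional and all points $x_0$.)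
   Context: $J_u$ denotes the jump set of $u$ (for the crack-tip, the half-line $\{\varphi=0\}$, i.e. the positive horizontal axis), $\nabla u$ the absolutely continuous part of its distributional derivative, $B_r(x_0)$ the disk of radius $r$ centered at $x_0$, and $\mathcal{H}^1$ the one-dimensional Hausdorff measure. The Mumford-Shah functional on $\Omega\subset\mathbb{R}^2$ is $E_{MS}[u]=\int_{\Omega\setminus J_u}|\nabla u|^2\,dx+\mathcal{H}^1(J_u)$. For a general minimizer $u$ and point $x_0\in\Omega$, $F(r,x_0)$ is defined by the same formula with $e_1$ replaced by $x_0$, for $0<r<\operatorname{dist}(x_0,\partial\Omega)$. It is a known theorem of Bonnet and David that the crack-tip is a global minimizer of the Mumford-Shah functional on $\mathbb{R}^2$; this may be used. *)

theory Defs
  imports "HOL-Analysis.Analysis"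
begin

type_synonym plane = "real^2"

text \<open>One-dimensional Hausdorff (outer) measure; in dimension one the usual normalising
  constant is 1. The library's \<open>diameter\<close> is meaningless on unbounded sets, hence \<open>bounded\<close>.\<close>

definition hausdorff1_pre :: "real \<Rightarrow> 'a::metric_space set \<Rightarrow> ennreal" where
  "hausdorff1_pre \<delta> A =
     (INF U \<in> {U :: nat \<Rightarrow> 'a set. A \<subseteq> (\<Union>i. U i) \<and> (\<forall>i. bounded (U i) \<and> diameter (U i) \<le> \<delta>)}.
        \<Sum>i. ennreal (diameter (U i)))"

definition hausdorff1 :: "'a::metric_space set \<Rightarrow> ennreal" where
  "hausdorff1 A = (SUP \<delta> \<in> {0<..}. hausdorff1_pre \<delta> A)"

text \<open>Functions on an open set \<open>\<Omega>\<close> are total functions whose values outside \<open>\<Omega>\<close> are irrelevant.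
  All notions below depend only on the almost-everywhere class of \<open>u\<close> on \<open>\<Omega>\<close>; Lebesgue measure is
  taken complete, so that arbitrary values on a null set do no harm.\<close>

definition half_ball :: "plane \<Rightarrow> real \<Rightarrow> plane \<Rightarrow> plane set" where
  "half_ball x r \<nu> = {y \<in> ball x r. (y - x) \<bullet> \<nu> > 0}"

definition has_one_sided_limit :: "(plane \<Rightarrow> real) \<Rightarrow> plane \<Rightarrow> plane \<Rightarrow> real \<Rightarrow> bool" where
  "has_one_sided_limit u x \<nu> a \<longleftrightarrow>
     ((\<lambda>r. (\<integral>\<^sup>+ y\<in>half_ball x r \<nu>. ennreal \<bar>u y - a\<bar> \<partial>lebesgue) / emeasure lebesgue (half_ball x r \<nu>))
        \<longlongrightarrow> 0) (at_right 0)"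

text \<open>The set of approximate jump points.\<close>

definition jump_set :: "(plane \<Rightarrow> real) \<Rightarrow> plane set" where
  "jump_set u = {x. \<exists>a b \<nu>. a \<noteq> b \<and> norm \<nu> = 1 \<and>
                     has_one_sided_limit u x \<nu> a \<and> has_one_sided_limit u x (- \<nu>) b}"

definition partial_deriv :: "2 \<Rightarrow> (plane \<Rightarrow> real) \<Rightarrow> plane \<Rightarrow> real" where
  "partial_deriv i \<phi> x = frechet_derivative \<phi> (at x) (axis i 1)"

definition C1_compact_support :: "plane set \<Rightarrow> (plane \<Rightarrow> real) set" where
  "C1_compact_support \<Omega> = {\<phi>. (\<forall>x. \<phi> differentiable (at x)) \<and>
      (\<forall>i. continuous_on UNIV (partial_deriv i \<phi>)) \<and>
      compact (closure {x. \<phi> x \<noteq> 0}) \<and> closure {x. \<phi> x \<noteq> 0} \<subseteq> \<Omega>}"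

definition locally_integrable :: "plane set \<Rightarrow> (plane \<Rightarrow> 'b::{banach, second_countable_topology}) \<Rightarrow> bool" where
  "locally_integrable \<Omega> f \<longleftrightarrow> (\<forall>K. compact K \<and> K \<subseteq> \<Omega> \<longrightarrow> set_integrable lebesgue K f)"

text \<open>Lebesgue decomposition of the distributional derivative of \<open>u\<close> on \<open>\<Omega>\<close>: it is the vector
  measure \<open>g dx + \<sigma> d\<mu>\<close>, where \<open>\<mu>\<close> (the total variation of the singular part) is a Radon
  measure on \<open>\<Omega>\<close> singular to Lebesgue measure, and \<open>\<sigma>\<close> is the unit density of the polar
  decomposition. Such data exist iff \<open>u\<close> is locally of bounded variation.\<close>

definition derivative_decomposition ::
  "plane set \<Rightarrow> (plane \<Rightarrow> real) \<Rightarrow> (plane \<Rightarrow> plane) \<Rightarrow> (plane \<Rightarrow> plane) \<Rightarrow> plane measure \<Rightarrow> bool" where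
  "derivative_decomposition \<Omega> u g \<sigma> \<mu> \<longleftrightarrow>
     g \<in> borel_measurable borel \<and> locally_integrable \<Omega> g \<and>
     sets \<mu> = sets borel \<and> (\<forall>K. compact K \<and> K \<subseteq> \<Omega> \<longrightarrow> emeasure \<mu> K < \<infinity>) \<and>
     (\<exists>N \<in> null_sets lborel. AE x in \<mu>. x \<in> \<Omega> \<inter> N) \<and>
     \<sigma> \<in> borel_measurable borel \<and> (AE x in \<mu>. norm (\<sigma> x) = 1) \<and>
     (\<forall>\<phi> \<in> C1_compact_support \<Omega>. \<forall>i.
        (\<integral>x. u x * partial_deriv i \<phi> x \<partial>lebesgue) =
          - (\<integral>x. \<phi> x * g x $ i \<partial>lebesgue) - (\<integral>x. \<phi> x * \<sigma> x $ i \<partial>\<mu>))"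

text \<open>The absolutely continuous part is unique up to null sets, so the choice below is immaterial
  inside integrals.\<close>

definition ac_gradient :: "plane set \<Rightarrow> (plane \<Rightarrow> real) \<Rightarrow> plane \<Rightarrow> plane" where
  "ac_gradient \<Omega> u = (SOME g. \<exists>\<sigma> \<mu>. derivative_decomposition \<Omega> u g \<sigma> \<mu>)"

text \<open>Local SBV: the singular part of the derivative is carried by the jump set
  (there is no Cantor part).\<close>

definition SBV_loc :: "plane set \<Rightarrow> (plane \<Rightarrow> real) set" where
  "SBV_loc \<Omega> = {u. locally_integrable \<Omega> u \<and>
     (\<exists>g \<sigma> \<mu>. derivative_decomposition \<Omega> u g \<sigma> \<mu> \<and> (AE x in \<mu>. x \<in> jump_set u))}"

definition dirichlet_energy :: "plane set \<Rightarrow> (plane \<Rightarrow> real) \<Rightarrow> plane set \<Rightarrow> ennreal" where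
  "dirichlet_energy \<Omega> u A =
     (\<integral>\<^sup>+ x\<in>A - jump_set u. ennreal ((norm (ac_gradient \<Omega> u x))\<^sup>2) \<partial>lebesgue)"

text \<open>The Mumford-Shah energy of \<open>u\<close>, a function on \<open>\<Omega>\<close>, localised to \<open>A \<subseteq> \<Omega>\<close>; the functional on
  \<open>\<Omega>\<close> is the case \<open>A = \<Omega>\<close>.\<close>

definition MS_energy :: "plane set \<Rightarrow> (plane \<Rightarrow> real) \<Rightarrow> plane set \<Rightarrow> ennreal" where
  "MS_energy \<Omega> u A = dirichlet_energy \<Omega> u A + hausdorff1 (jump_set u \<inter> A)"

text \<open>Minimality among competitors agreeing with \<open>u\<close> off a compact subset of \<open>\<Omega>\<close>. As the energy on
  \<open>\<Omega>\<close> may be infinite, energies are compared on relatively compact open sets containing the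
  perturbation; for \<open>\<Omega> = UNIV\<close> these are the global minimizers.\<close>

definition MS_minimizer :: "plane set \<Rightarrow> (plane \<Rightarrow> real) \<Rightarrow> bool" where
  "MS_minimizer \<Omega> u \<longleftrightarrow> open \<Omega> \<and> u \<in> SBV_loc \<Omega> \<and>
     (\<forall>A. open A \<and> compact (closure A) \<and> closure A \<subseteq> \<Omega> \<longrightarrow>
        MS_energy \<Omega> u A < \<infinity> \<and>
        (\<forall>v \<in> SBV_loc \<Omega>. closure {x \<in> \<Omega>. v x \<noteq> u x} \<subseteq> A \<longrightarrow> MS_energy \<Omega> u A \<le> MS_energy \<Omega> v A))"

definition F :: "plane set \<Rightarrow> (plane \<Rightarrow> real) \<Rightarrow> real \<Rightarrow> plane \<Rightarrow> ennreal" where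
  "F \<Omega> u r x0 =
     (dirichlet_energy \<Omega> u (ball x0 r) + hausdorff1 (jump_set u \<inter> ball x0 r) / 2) / ennreal r"

text \<open>Radii \<open>0 < r < dist(x0, \<partial>\<Omega>)\<close>; the infimum over an empty boundary is infinite
  (unlike \<open>infdist\<close>).\<close>

definition radii :: "plane set \<Rightarrow> plane \<Rightarrow> real set" where
  "radii \<Omega> x0 = {r. 0 < r \<and> ereal r < (INF y \<in> frontier \<Omega>. ereal (dist x0 y))}"

text \<open>The polar formula determines the crack-tip off the half-line, a null set; no value is
  prescribed on it.\<close>

definition crack_tip :: "(plane \<Rightarrow> real) \<Rightarrow> bool" where
  "crack_tip u \<longleftrightarrow> (\<forall>\<rho> \<phi>. 0 < \<rho> \<and> 0 < \<phi> \<and> \<phi> < 2 * pi \<longrightarrow>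
     u (vector [\<rho> * cos \<phi>, \<rho> * sin \<phi>]) = sqrt (2 / pi) * \<rho> powr (1 / 2) * cos (\<phi> / 2))"

end

theory Submission
  imports Defs
begin

text \<open>Off the half-line, \<open>|\<nabla>u|\<^sup>2 = 1/(2\<pi>|x|)\<close>, which has integral \<open>s\<close> over the disc of radius \<open>s\<close> about
  the tip. As \<open>B\<^sub>r(e\<^sub>1) \<subseteq> B\<^sub>r\<^sub>+\<^sub>1(0)\<close> and the jump set has length \<open>1 + r\<close> in \<open>B\<^sub>r(e\<^sub>1)\<close> for \<open>r \<ge> 1\<close>,
  \<open>F(r, e\<^sub>1) \<le> 3/2 + 3/(2r)\<close>. So it suffices to find one radius with \<open>F(r, e\<^sub>1) > 3/2\<close>, that is,
  with Dirichlet energy above \<open>r - 1/2\<close>; \<open>r = 100\<close> leaves enough room for crude estimates.\<close>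

section \<open>The jump set of the crack-tip\<close>

text \<open>The value 3/2 is the limit of F(r, e1), approached from above. Moving the centre of the
  disc from the tip to e1 lengthens the enclosed crack by exactly 1 when r is at least 1, whereas
  the Dirichlet energy, the angular mean of cos t + sqrt(r^2 - sin^2 t), is r - 1/(4r) + ... and so
  changes only at order 1/r. Hence F = 3/2 + 1/(2r) + O(1/r^2): the decrease happens arbitrarily
  close above 3/2, where truncation at any a > 3/2 has no effect. Most of the work justifies the
  formula for the gradient. \<open>ac_gradient\<close> is an arbitrary choice among the Lebesgue
  decompositions of the distributional derivative, so one decomposition has to be exhibited, by
  integrating by parts across the crack, and the densities of any two have to be shown equal almost
  everywhere. Likewise \<open>jump_set\<close> is defined by averages over half discs and must be
  located from ordinary limits. The values of \<open>u\<close> on the half-line are arbitrary, so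
  \<open>u\<close> is replaced by an explicit Borel function.\<close>

lemma norm_plane: "norm (x::plane) = sqrt ((x$1)\<^sup>2 + (x$2)\<^sup>2)"
  by (simp add: norm_vec_def L2_set_def sum_2)

lemma norm_plus_component_nonneg: "0 \<le> norm x + x$1" for x :: plane
  using component_le_norm_cart[of x 1] by linarith

text \<open>Closed, with the tip included. The jump set is only pinned down between the open and the
  closed half-line, which have the same length.\<close>

definition slit :: "plane set" where
  "slit = {x. x$2 = 0 \<and> 0 \<le> x$1}"

text \<open>Cartesian form of the crack-tip, free of the choice of an angle, hence visibly Borel and
  easy to differentiate. On the slit \<open>sgn\<close> gives the value 0, the mean of the two
  traces.\<close>

definition tip :: "plane \<Rightarrow> real" where
  "tip x = sgn (x$2) * sqrt ((norm x + x$1) / pi)"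

text \<open>The half-angle formula \<rho> (1 + cos t) = 2 \<rho> cos^2 (t/2) gives the modulus. The
  sign of cos (t/2) is that of the second coordinate, because sin (t/2) > 0 for 0 < t < 2
  pi.\<close>

lemma crack_tip_eq_tip:
  assumes u: "crack_tip u" and x: "x \<notin> slit"
  shows "u x = tip x"
proof -
  define \<rho> where "\<rho> = norm x"
  have \<rho>: "\<rho> > 0" using x by (auto simp: \<rho>_def slit_def)
  have sq: "\<rho>\<^sup>2 = (x$1)\<^sup>2 + (x$2)\<^sup>2" by (simp add: \<rho>_def norm_plane)
  have "(x$1 / \<rho>)\<^sup>2 + (x$2 / \<rho>)\<^sup>2 = 1"
    using \<rho> by (simp add: power_divide sq[symmetric] flip: add_divide_distrib)
  then obtain t where t: "0 \<le> t" "t < 2*pi" and ct: "x$1 / \<rho> = cos t" and st: "x$2 / \<rho> = sin t"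
    by (rule sincos_total_2pi)
  have x1: "x$1 = \<rho> * cos t" and x2: "x$2 = \<rho> * sin t" using ct st \<rho> by (auto simp: field_simps)
  have "t \<noteq> 0" using x x1 x2 \<rho> by (auto simp: slit_def)
  then have t0: "0 < t" using t by simp
  have xv: "x = vector [\<rho> * cos t, \<rho> * sin t]"
    by (simp add: vec_eq_iff forall_2 vector_2 x1 x2)
  have ux: "u x = sqrt (2 / pi) * \<rho> powr (1/2) * cos (t/2)"
    using u \<rho> t0 t unfolding crack_tip_def xv by blast
  have s: "sin (t/2) > 0" using t0 t by (intro sin_gt_zero) auto
  have sint: "sin t = 2 * sin (t/2) * cos (t/2)" using sin_double[of "t/2"] by simp
  have cost: "1 + cos t = 2 * (cos (t/2))\<^sup>2" using cos_double_cos[of "t/2"] by simp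
  have sg: "sgn (x$2) = sgn (cos (t/2))" using s \<rho> by (simp add: x2 sint sgn_mult)
  have "norm x + x$1 = \<rho> * (1 + cos t)" by (simp add: x1 \<rho>_def[symmetric] distrib_left)
  then have "(norm x + x$1) / pi = 2 / pi * \<rho> * (cos (t/2))\<^sup>2" by (simp add: cost)
  then have "sqrt ((norm x + x$1) / pi) = sqrt (2 / pi) * sqrt \<rho> * \<bar>cos (t/2)\<bar>"
    by (simp add: real_sqrt_mult real_sqrt_divide)
  then show ?thesis
    using \<rho> by (simp add: ux tip_def sg powr_half_sqrt mult.left_commute sgn_mult_abs mult.assoc)
qed

lemma closed_slit: "closed slit"
proof -
  have "slit = {x. x$2 = 0} \<inter> {x. 0 \<le> x$1}" by (auto simp: slit_def)
  moreover have "closed {x::plane. x$2 = 0}" "closed {x::plane. 0 \<le> x$1}"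
    by (intro closed_Collect_eq closed_Collect_le continuous_intros)+
  ultimately show ?thesis by (metis closed_Int)
qed

lemma negligible_axis: "negligible {x::plane. x$2 = 0}"
  by (rule negligible_standard_hyperplane_cart)

lemma null_axis: "{x::plane. x$2 = 0} \<in> null_sets lborel"
proof -
  have "{x::plane. x$2 = 0} \<in> sets borel" by measurable
  then show ?thesis using negligible_axis
    by (simp add: negligible_iff_null_sets null_sets_completion_iff)
qed

text \<open>The only delicate points are those of the negative axis: \<open>sgn\<close> jumps there,
  but the root it multiplies tends to 0.\<close>

lemma tip_tendsto:
  assumes "x \<notin> slit"
  shows "(tip \<longlongrightarrow> tip x) (at x)"
proof (cases "x$2 = 0")
  case True
  then have x1: "x$1 < 0" using assms by (auto simp: slit_def)
  then have z: "norm x + x$1 = 0" using True by (simp add: norm_plane)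
  have "((\<lambda>y. sqrt ((norm y + y$1) / pi)) \<longlongrightarrow> sqrt ((norm x + x$1) / pi)) (at x)"
    by (intro tendsto_intros) auto
  then have "((\<lambda>y. sqrt ((norm y + y$1) / pi)) \<longlongrightarrow> 0) (at x)" using z by simp
  then have "(tip \<longlongrightarrow> 0) (at x)"
    by (rule Lim_null_comparison[rotated])
       (auto simp: tip_def abs_mult abs_sgn_eq norm_plus_component_nonneg intro!: always_eventually)
  then show ?thesis using True by (simp add: tip_def)
next
  case False
  then have "((\<lambda>y. sgn (y$2) * sqrt ((norm y + y$1) / pi)) \<longlongrightarrow> sgn (x$2) * sqrt ((norm x + x$1) / pi)) (at x)"
    by (intro tendsto_intros) auto
  then show ?thesis by (simp add: tip_def[abs_def])
qed

section \<open>Approximate one-sided limits compared with ordinary limits\<close>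

lemma half_ball_measure:
  assumes "r > 0" "norm \<nu> = 1"
  shows "0 < emeasure lebesgue (half_ball x r \<nu>)" "emeasure lebesgue (half_ball x r \<nu>) < \<infinity>"
    "half_ball x r \<nu> \<in> sets lebesgue"
proof -
  have hb: "half_ball x r \<nu> = ball x r \<inter> {y. (y - x) \<bullet> \<nu> > 0}" by (auto simp: half_ball_def)
  have op: "open (half_ball x r \<nu>)"
    unfolding hb by (intro open_Int open_ball open_Collect_less continuous_intros)
  then show s: "half_ball x r \<nu> \<in> sets lebesgue" by (simp add: borel_open)
  have "x + (r/2) *\<^sub>R \<nu> \<in> half_ball x r \<nu>"
    using assms by (auto simp: half_ball_def dist_norm power2_norm_eq_inner[symmetric])
  then have "\<not> negligible (half_ball x r \<nu>)" using open_not_negligible[OF op] by auto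
  then show "0 < emeasure lebesgue (half_ball x r \<nu>)"
    using s by (auto simp: negligible_iff_null_sets null_sets_def zero_less_iff_neq_zero)
  have "bounded (half_ball x r \<nu>)" unfolding hb by (simp add: bounded_Int)
  then show "emeasure lebesgue (half_ball x r \<nu>) < \<infinity>"
    using emeasure_bounded_finite[of "half_ball x r \<nu>"] op by (simp add: borel_open top.not_eq_extremum)
qed

lemma has_one_sided_limitI:
  assumes lim: "(u \<longlongrightarrow> a) (at x within {y. (y - x) \<bullet> \<nu> > 0})" and \<nu>: "norm \<nu> = 1"
  shows "has_one_sided_limit u x \<nu> a"
  unfolding has_one_sided_limit_def
proof (rule order_tendstoI)
  fix l :: ennreal assume "0 < l"
  \<comment> \<open>The target neighbourhood is bounded by an \<open>ennreal\<close>, possibly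
    \<open>top\<close>; a number strictly below it is finite and can serve as a real
    tolerance.\<close>
  then obtain e where e: "0 < e" "e < l" using dense by blast
  then have "e < top" using less_top order.strict_trans2 top_greatest by blast
  then obtain e' where e': "e = ennreal e'" "0 < e'" using e by (cases e) auto
  obtain d where d: "d > 0"
    "\<And>y. (y - x) \<bullet> \<nu> > 0 \<Longrightarrow> dist y x < d \<Longrightarrow> dist (u y) a < e'"
    using lim[unfolded tendsto_iff eventually_at, rule_format, OF e'(2)] by (auto 0 3 dest: spec[of _ x]) (metis diff_self inner_zero_left less_irrefl)
  show "\<forall>\<^sub>F r in at_right 0. (\<integral>\<^sup>+ y\<in>half_ball x r \<nu>. ennreal \<bar>u y - a\<bar> \<partial>lebesgue) /
      emeasure lebesgue (half_ball x r \<nu>) < l"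
    unfolding eventually_at_right_field
  proof (intro exI[of _ d] conjI allI impI)
    fix r assume r: "0 < r" "r < d"
    note m = half_ball_measure[OF r(1) \<nu>, of x]
    have "(\<integral>\<^sup>+ y\<in>half_ball x r \<nu>. ennreal \<bar>u y - a\<bar> \<partial>lebesgue) \<le> (\<integral>\<^sup>+ y\<in>half_ball x r \<nu>. e \<partial>lebesgue)"
      using d r by (intro nn_integral_mono)
        (auto simp: half_ball_def indicator_def e' dist_real_def dist_commute ennreal_leI less_imp_le)
    also have "\<dots> = e * emeasure lebesgue (half_ball x r \<nu>)"
      using m by (simp add: nn_integral_cmult_indicator)
    finally have "(\<integral>\<^sup>+ y\<in>half_ball x r \<nu>. ennreal \<bar>u y - a\<bar> \<partial>lebesgue) / emeasure lebesgue (half_ball x r \<nu>)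
      \<le> e * emeasure lebesgue (half_ball x r \<nu>) / emeasure lebesgue (half_ball x r \<nu>)"
      by (rule divide_right_mono_ennreal)
    \<comment> \<open>Cancelling in \<open>ennreal\<close> requires the measure of the half ball to
      be neither 0 nor infinite.\<close>
    also have "\<dots> = e" using m by (simp add: ennreal_mult_divide_eq less_top[symmetric] zero_less_iff_neq_zero)
    finally show "(\<integral>\<^sup>+ y\<in>half_ball x r \<nu>. ennreal \<bar>u y - a\<bar> \<partial>lebesgue) / emeasure lebesgue (half_ball x r \<nu>) < l"
      using e by simp
  qed (use d in auto)
qed simp

text \<open>If \<open>a\<close> differed from the ordinary limit \<open>c\<close>, then \<bar>u -
  a\<bar> would exceed half of \<bar>c - a\<bar> on all small half balls, and so would its
  averages.\<close>

lemma has_one_sided_limit_unique: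
  assumes lim: "(u \<longlongrightarrow> c) (at x within {y. (y - x) \<bullet> \<nu> > 0})" and \<nu>: "norm \<nu> = 1"
    and os: "has_one_sided_limit u x \<nu> a"
  shows "a = c"
proof (rule ccontr)
  assume "a \<noteq> c"
  define e where "e = \<bar>c - a\<bar> / 2"
  have e: "e > 0" using \<open>a \<noteq> c\<close> by (simp add: e_def)
  obtain d where d: "d > 0"
    "\<And>y. (y - x) \<bullet> \<nu> > 0 \<Longrightarrow> dist y x < d \<Longrightarrow> dist (u y) c < e"
    using lim[unfolded tendsto_iff eventually_at, rule_format, OF e] by (auto 0 3 dest: spec[of _ x]) (metis diff_self inner_zero_left less_irrefl)
  have "\<forall>\<^sub>F r in at_right 0. (\<integral>\<^sup>+ y\<in>half_ball x r \<nu>. ennreal \<bar>u y - a\<bar> \<partial>lebesgue) /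
      emeasure lebesgue (half_ball x r \<nu>) < ennreal e"
    using os e unfolding has_one_sided_limit_def by (intro order_tendstoD(2)) auto
  moreover have "\<forall>\<^sub>F r in at_right 0. 0 < r \<and> r < d"
    using d(1) by (auto simp: eventually_at_right_field)
  ultimately have "\<forall>\<^sub>F r in at_right (0::real). False"
  proof eventually_elim
    fix r assume L: "(\<integral>\<^sup>+ y\<in>half_ball x r \<nu>. ennreal \<bar>u y - a\<bar> \<partial>lebesgue) /
      emeasure lebesgue (half_ball x r \<nu>) < ennreal e" and r: "0 < r \<and> r < d"
    note m = half_ball_measure[OF conjunct1[OF r] \<nu>, of x]
    have "e < \<bar>u y - a\<bar>" if "y \<in> half_ball x r \<nu>" for y
    proof -
      have "\<bar>u y - c\<bar> < \<bar>c - a\<bar> / 2"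
        using d(2)[of y] that r by (auto simp: half_ball_def e_def dist_real_def dist_commute)
      then show ?thesis using abs_triangle_ineq[of "c - u y" "u y - a"] unfolding e_def
        by (simp add: abs_minus_commute)
    qed
    then have "e \<le> \<bar>u y - a\<bar>" if "y \<in> half_ball x r \<nu>" for y
      using that by fastforce
    then have "(\<integral>\<^sup>+ y\<in>half_ball x r \<nu>. ennreal e \<partial>lebesgue) \<le> (\<integral>\<^sup>+ y\<in>half_ball x r \<nu>. ennreal \<bar>u y - a\<bar> \<partial>lebesgue)"
      by (intro nn_integral_mono) (auto simp: indicator_def ennreal_leI less_imp_le)
    then have "ennreal e * emeasure lebesgue (half_ball x r \<nu>) / emeasure lebesgue (half_ball x r \<nu>)
        \<le> (\<integral>\<^sup>+ y\<in>half_ball x r \<nu>. ennreal \<bar>u y - a\<bar> \<partial>lebesgue) / emeasure lebesgue (half_ball x r \<nu>)"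
      using m by (intro divide_right_mono_ennreal) (simp add: nn_integral_cmult_indicator)
    also note L
    finally show False
      using m by (simp add: ennreal_mult_divide_eq less_top[symmetric] zero_less_iff_neq_zero)
  qed
  then show False by simp
qed

text \<open>The slit is closed, so near a point off it \<open>u\<close> coincides with
  \<open>tip\<close> and has a full limit; both approximate one-sided limits then equal it, in any
  direction \<nu>.\<close>

lemma jump_set_crack_tip_subset:
  assumes "crack_tip u"
  shows "jump_set u \<subseteq> slit"
proof
  fix x assume "x \<in> jump_set u"
  then obtain a b \<nu> where ab: "a \<noteq> b" "norm \<nu> = 1" "has_one_sided_limit u x \<nu> a" "has_one_sided_limit u x (-\<nu>) b"
    by (auto simp: jump_set_def)
  show "x \<in> slit"
  proof (rule ccontr)
    assume x: "x \<notin> slit"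
    have "\<forall>\<^sub>F y in nhds x. y \<in> - slit"
      using x closed_slit by (intro eventually_nhds_in_open) (auto simp: open_Compl)
    then have "\<forall>\<^sub>F y in at x. u y = tip y"
      unfolding eventually_at_filter by eventually_elim (auto simp: crack_tip_eq_tip[OF assms])
    then have L: "(u \<longlongrightarrow> tip x) (at x)" using tip_tendsto[OF x] by (simp add: tendsto_cong)
    have "a = tip x" "b = tip x"
      using has_one_sided_limit_unique[OF tendsto_within_subset[OF L] ab(2,3)]
        has_one_sided_limit_unique[OF tendsto_within_subset[OF L] _ ab(4)] ab(2) by simp_all
    then show False using ab by simp
  qed
qed

text \<open>The traces from above and from below are \<open>c\<close> and \<open>-c\<close>, and
  they differ because \<open>c > 0\<close> away from the tip.\<close>

lemma jump_set_crack_tip_superset: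
  assumes "crack_tip u" and x: "x$2 = 0" "x$1 > 0"
  shows "x \<in> jump_set u"
proof -
  define c where "c = sqrt ((norm x + x$1) / pi)"
  have c: "c > 0" using x by (simp add: c_def add_nonneg_pos)
  have L: "((\<lambda>y. sqrt ((norm y + y$1) / pi)) \<longlongrightarrow> c) (at x within S)" for S
    unfolding c_def by (intro tendsto_intros) auto
  let ?e = "axis 2 1 :: plane"
  have e: "(y - x) \<bullet> ?e = y$2" for y using x by (simp add: inner_axis)
  have "(u \<longlongrightarrow> c) (at x within {y. (y - x) \<bullet> ?e > 0})"
    by (rule Lim_transform_within[OF L zero_less_one])
       (auto simp: e tip_def crack_tip_eq_tip[OF assms(1)] slit_def)
  moreover have "(u \<longlongrightarrow> -c) (at x within {y. (y - x) \<bullet> - ?e > 0})"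
    by (rule Lim_transform_within[OF tendsto_minus[OF L] zero_less_one])
       (auto simp: e tip_def crack_tip_eq_tip[OF assms(1)] slit_def)
  ultimately show ?thesis
    using c unfolding jump_set_def mem_Collect_eq
    by (intro exI[of _ c] exI[of _ "-c"] exI[of _ ?e]) (auto intro!: has_one_sided_limitI)
qed

section \<open>Length of the jump set\<close>

text \<open>A 1-Lipschitz projection maps each covering set into an interval no longer than its
  diameter, and these intervals cover \<open>{a<..<b}\<close>; countable subadditivity of Lebesgue
  measure concludes.\<close>

lemma hausdorff1_ge_of_projection:
  fixes p :: "'a::metric_space \<Rightarrow> real"
  assumes p: "\<And>x y. \<bar>p x - p y\<bar> \<le> dist x y" and A: "{a<..<b} \<subseteq> p ` A"
  shows "ennreal (b - a) \<le> hausdorff1 A"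
proof -
  \<comment> \<open>\<open>hausdorff1\<close> is a supremum over scales, so a bound at one scale,
    here arbitrarily 1, is enough.\<close>
  have "ennreal (b - a) \<le> hausdorff1_pre 1 A"
    unfolding hausdorff1_pre_def
  proof (intro INF_greatest)
    fix U :: "nat \<Rightarrow> 'a set" assume "U \<in> {U. A \<subseteq> (\<Union>i. U i) \<and> (\<forall>i. bounded (U i) \<and> diameter (U i) \<le> 1)}"
    then have U: "A \<subseteq> (\<Union>i. U i)" "\<And>i. bounded (U i)" by auto
    \<comment> \<open>Empty covering sets are treated apart, since \<open>Inf\<close> and
      \<open>Sup\<close> of the empty set carry no information.\<close>
    define J where "J i = (if U i = {} then {} else {Inf (p ` U i)..Sup (p ` U i)})" for i
    have J: "p ` U i \<subseteq> J i \<and> emeasure lborel (J i) \<le> ennreal (diameter (U i))" for i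
    proof (cases "U i = {}")
      case False
      have d: "p x \<le> p y + diameter (U i)" if "x \<in> U i" "y \<in> U i" for x y
        using p[of x y] diameter_bounded_bound[OF U(2) that] by linarith
      have ba: "bdd_above (p ` U i)" "bdd_below (p ` U i)"
        using d False by (auto simp: bdd_above_def bdd_below_def) (meson d diff_le_eq ex_in_conv)+
      have "Sup (p ` U i) - diameter (U i) \<le> p y" if "y \<in> U i" for y
        using cSup_least[of "p ` U i" "p y + diameter (U i)"] False d that by fastforce
      then have "Sup (p ` U i) - diameter (U i) \<le> Inf (p ` U i)"
        using False by (intro cInf_greatest) auto
      moreover have "Inf (p ` U i) \<le> Sup (p ` U i)" using False ba by (intro cInf_le_cSup) auto
      ultimately show ?thesis
        using False cInf_lower[OF _ ba(2)] cSup_upper[OF _ ba(1)] by (auto simp: J_def intro!: ennreal_leI)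
    qed (simp add: J_def)
    have Js: "J i \<in> sets lborel" for i by (simp add: J_def)
    have "ennreal (b - a) \<le> emeasure lborel {a<..<b}"
      by (cases "a \<le> b") (auto simp: ennreal_neg)
    also have "\<dots> \<le> emeasure lborel (\<Union>i. J i)"
    proof (rule emeasure_mono)
      show "{a<..<b} \<subseteq> (\<Union>i. J i)"
      proof
        fix t assume "t \<in> {a<..<b}"
        then obtain x where "x \<in> A" "t = p x" using A by blast
        then obtain i where "p x \<in> p ` U i" using U(1) by blast
        then show "t \<in> (\<Union>i. J i)" using J[of i] \<open>t = p x\<close> by blast
      qed
    qed (use Js in auto)
    also have "\<dots> \<le> (\<Sum>i. emeasure lborel (J i))"
      using Js by (intro emeasure_subadditive_countably) auto
    also have "\<dots> \<le> (\<Sum>i. ennreal (diameter (U i)))"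
      using J by (intro suminf_le) auto
    finally show "ennreal (b - a) \<le> (\<Sum>i. ennreal (diameter (U i)))" .
  qed
  also have "\<dots> \<le> hausdorff1 A" unfolding hausdorff1_def by (rule SUP_upper) simp
  finally show ?thesis .
qed

text \<open>Cutting the parameter interval into \<open>n\<close> equal pieces of length
  \<open>h \<le> \<delta>\<close> covers the set by images of diameter at most \<open>h\<close>,
  with total length \<open>n * h = L\<close> at every scale.\<close>

lemma hausdorff1_le_of_path:
  fixes \<gamma> :: "real \<Rightarrow> 'a::metric_space"
  assumes \<gamma>: "\<And>s t. dist (\<gamma> s) (\<gamma> t) \<le> \<bar>s - t\<bar>" and A: "A \<subseteq> \<gamma> ` {0..L}" and L: "0 < L"
  shows "hausdorff1 A \<le> ennreal L"
  unfolding hausdorff1_def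
proof (intro SUP_least)
  fix \<delta> :: real assume "\<delta> \<in> {0<..}"
  then have \<delta>: "\<delta> > 0" by simp
  obtain n :: nat where n: "L / \<delta> < n" using reals_Archimedean2 by blast
  moreover have "0 < L / \<delta>" using L \<delta> by simp
  ultimately have n0: "n > 0" by (metis less_trans of_nat_0_less_iff)
  define h where "h = L / n"
  have h: "h > 0" "h \<le> \<delta>" "L = n * h" using n n0 \<delta> L by (auto simp: h_def field_simps)
  define U where "U i = (if i < n then \<gamma> ` {i * h..(i + 1) * h} else {})" for i :: nat
  have U: "bounded (U i) \<and> diameter (U i) \<le> (if i < n then h else 0)" for i
  proof (cases "i < n")
    case True
    have d: "dist x y \<le> h" if "x \<in> U i" "y \<in> U i" for x y
    proof -
      have "x \<in> \<gamma> ` {i * h..(i + 1) * h}" "y \<in> \<gamma> ` {i * h..(i + 1) * h}"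
        using that True by (simp_all add: U_def)
      then obtain s t where st: "x = \<gamma> s" "y = \<gamma> t" "s \<in> {i * h..(i + 1) * h}" "t \<in> {i * h..(i + 1) * h}"
        by blast
      then have "\<bar>s - t\<bar> \<le> h" by (auto simp: algebra_simps abs_le_iff)
      then show ?thesis unfolding st(1,2) by (rule order_trans[OF \<gamma>])
    qed
    have "bounded (U i)" by (rule bounded_two_points[THEN iffD2]) (use d in blast)
    moreover have "U i \<noteq> {}" using True h by (auto simp: U_def algebra_simps)
    ultimately show ?thesis
      using d True by (auto simp: diameter_def intro!: cSUP_least)
  qed (simp add: U_def)
  have dU: "diameter (U i) \<le> h" for i using U[of i] h by (auto split: if_splits)
  have "A \<subseteq> (\<Union>i. U i)"
  proof
    fix x assume "x \<in> A"
    then obtain t where t: "x = \<gamma> t" "0 \<le> t" "t \<le> n * h" using A h by auto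
    \<comment> \<open>The right end point belongs to the last piece, of index \<open>n - 1\<close>;
      the floor of \<open>t / h\<close> would give the index \<open>n\<close>, whose piece is
      empty.\<close>
    show "x \<in> (\<Union>i. U i)"
    proof (cases "t = n * h")
      case True
      then have "t \<in> {real (n - 1) * h..(real (n - 1) + 1) * h}"
        using n0 h by (auto simp: of_nat_diff algebra_simps)
      then show ?thesis using n0 t(1) by (intro UN_I[of "n - 1"]) (auto simp: U_def)
    next
      case False
      define i where "i = nat \<lfloor>t / h\<rfloor>"
      have i: "real i = \<lfloor>t / h\<rfloor>" using t h by (simp add: i_def)
      have "i \<le> t / h" "t / h \<le> real i + 1" unfolding i by linarith+
      then have it: "i * h \<le> t" "t \<le> (i + 1) * h" using h by (simp_all add: field_simps)
      have "real i * h < n * h" using it t False by linarith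
      then have "i < n" using h by simp
      then show ?thesis using it t by (auto simp: U_def)
    qed
  qed
  moreover have "bounded (U i)" "diameter (U i) \<le> \<delta>" for i using U[of i] dU[of i] h by auto
  ultimately have "hausdorff1_pre \<delta> A \<le> (\<Sum>i. ennreal (diameter (U i)))"
    unfolding hausdorff1_pre_def by (intro INF_lower) auto
  also have "\<dots> = (\<Sum>i<n. ennreal (diameter (U i)))"
    by (intro suminf_finite) (auto simp: U_def)
  also have "\<dots> \<le> (\<Sum>i<n. ennreal h)" using dU by (intro sum_mono ennreal_leI)
  also have "\<dots> = ennreal L" using h by (simp add: ennreal_of_nat_eq_real_of_nat ennreal_mult)
  finally show "hausdorff1_pre \<delta> A \<le> ennreal L" .
qed

text \<open>For \<open>r \<ge> 1\<close> the tip lies in the closed disc, so the crack meets the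
  disc in a segment from 0 to \<open>1 + r\<close>. The path bound uses the closed segment and the
  projection bound the open one, so the undecided end points do no harm.\<close>

lemma hausdorff1_jump_set:
  assumes "crack_tip u" "r \<ge> 1"
  shows "hausdorff1 (jump_set u \<inter> ball (vector [1, 0]) r) = ennreal (1 + r)"
proof (rule antisym)
  let ?\<gamma> = "\<lambda>t. t *\<^sub>R axis 1 1 :: plane"
  have e: "vector [1, 0] = (axis 1 1 :: plane)" by (simp add: vec_eq_iff forall_2 axis_def)
  show "hausdorff1 (jump_set u \<inter> ball (vector [1, 0]) r) \<le> ennreal (1 + r)"
  proof (rule hausdorff1_le_of_path)
    show "dist (?\<gamma> s) (?\<gamma> t) \<le> \<bar>s - t\<bar>" for s t
      by (simp add: dist_norm flip: scaleR_diff_left)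
    show "jump_set u \<inter> ball (vector [1, 0]) r \<subseteq> ?\<gamma> ` {0..1 + r}"
    proof
      fix x assume x: "x \<in> jump_set u \<inter> ball (vector [1, 0]) r"
      then have s: "x$2 = 0" "0 \<le> x$1" using jump_set_crack_tip_subset[OF assms(1)] by (auto simp: slit_def)
      have "norm (x - axis 1 1) < r" using x by (simp add: e dist_norm norm_minus_commute)
      then have "\<bar>x$1 - 1\<bar> < r"
        using component_le_norm_cart[of "x - axis 1 1" 1] by simp
      then have "x$1 \<in> {0..1 + r}" using s by auto
      moreover have "x = ?\<gamma> (x$1)" using s by (simp add: vec_eq_iff forall_2 axis_def)
      ultimately show "x \<in> ?\<gamma> ` {0..1 + r}" by (rule rev_image_eqI)
    qed
  qed (use assms in auto)
  have "ennreal (1 + r - 0) \<le> hausdorff1 (jump_set u \<inter> ball (vector [1, 0]) r)"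
  proof (rule hausdorff1_ge_of_projection[where p = "\<lambda>x. x$1"])
    show "\<bar>x$1 - y$1\<bar> \<le> dist x y" for x y :: plane
      using component_le_norm_cart[of "x - y" 1] by (simp add: dist_norm)
    show "{0<..<1 + r} \<subseteq> (\<lambda>x. x$1) ` (jump_set u \<inter> ball (vector [1, 0]) r)"
    proof
      fix t assume t: "t \<in> {0<..<1 + r}"
      have "?\<gamma> t \<in> jump_set u"
        using t by (intro jump_set_crack_tip_superset[OF assms(1)]) (auto simp: axis_def)
      have "axis 1 1 - ?\<gamma> t = (1 - t) *\<^sub>R axis 1 1" by (simp add: algebra_simps)
      moreover have "\<bar>1 - t\<bar> < r" using t assms(2) unfolding abs_less_iff by simp
      ultimately have "?\<gamma> t \<in> ball (axis 1 1) r"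
        by (simp add: dist_norm)
      with \<open>?\<gamma> t \<in> jump_set u\<close> show "t \<in> (\<lambda>x. x$1) ` (jump_set u \<inter> ball (vector [1, 0]) r)"
        by (intro rev_image_eqI[of "?\<gamma> t"]) (auto simp: e axis_def)
    qed
  qed
  then show "ennreal (1 + r) \<le> hausdorff1 (jump_set u \<inter> ball (vector [1, 0]) r)" by simp
qed

section \<open>Dirichlet energy of discs\<close>

text \<open>The expected Dirichlet energy as a measure, so that discs can be compared by
  monotonicity and additivity before the gradient is identified. At the origin the density is 1/0 =
  0, which concerns a null set only.\<close>

definition tip_energy :: "plane measure" where
  "tip_energy = density lborel (\<lambda>x. ennreal (1 / (2 * pi * norm x)))"

lemma sets_tip_energy[simp, measurable_cong]: "sets tip_energy = sets borel"
  by (simp add: tip_energy_def)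

lemma emeasure_tip_energy:
  "A \<in> sets borel \<Longrightarrow> emeasure tip_energy A = (\<integral>\<^sup>+x\<in>A. ennreal (1 / (2 * pi * norm x)) \<partial>lborel)"
  by (simp add: tip_energy_def emeasure_density)

text \<open>With \<open>c = 1 / (2 * pi)\<close> and \<open>a = norm x\<close> this represents the
  energy density as a superposition of indicators.\<close>

lemma nn_integral_inverse_square:
  assumes "c \<ge> 0" "a > 0"
  shows "(\<integral>\<^sup>+t. ennreal (c / t\<^sup>2) * indicator {a..} t \<partial>lborel) = ennreal (c / a)"
proof -
  have "(\<integral>\<^sup>+t. ennreal (c / t\<^sup>2) * indicator {a..} t \<partial>lborel) = ennreal (0 - (- c / a))"
  proof (rule nn_integral_FTC_atLeast)
    show "DERIV (\<lambda>t. - c / t) x :> c / x\<^sup>2" if "a \<le> x" for x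
      using that assms by (auto intro!: derivative_eq_intros simp: power2_eq_square)
    show "((\<lambda>t. - c / t) \<longlongrightarrow> 0) at_top"
      by (rule tendsto_divide_0[OF tendsto_const]) (simp add: filterlim_at_top_imp_at_infinity filterlim_ident)
  qed (use assms in auto)
  then show ?thesis by simp
qed

lemma emeasure_plane_ball: "r \<ge> 0 \<Longrightarrow> emeasure lborel (ball (x::plane) r) = ennreal (pi * r\<^sup>2)"
  by (simp add: emeasure_ball unit_ball_vol_2)

lemma emeasure_plane_cball: "r \<ge> 0 \<Longrightarrow> emeasure lborel (cball (x::plane) r) = ennreal (pi * r\<^sup>2)"
  by (simp add: emeasure_cball unit_ball_vol_2)

text \<open>Layer-cake argument: 1/\<bar>x\<bar> is the integral of 1/t^2 over t \<ge>
  \<bar>x\<bar>. After exchanging the integrals only the area of the disc of radius min(t, s) is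
  needed. The integrand becomes 1/2 for 0 < t < s and s^2 / (2 t^2) for t \<ge> s, and each range
  contributes s/2.\<close>

lemma emeasure_tip_energy_ball:
  assumes s: "s > 0"
  shows "emeasure tip_energy (ball 0 s) = ennreal s"
proof -
  let ?w = "\<lambda>t::real. ennreal (1 / (2 * pi) / t\<^sup>2)"
  have nz: "AE x::plane in lborel. x \<noteq> 0"
    by (rule AE_I[of _ _ "{0}"]) auto
  have "emeasure tip_energy (ball 0 s) =
      (\<integral>\<^sup>+x. (\<integral>\<^sup>+t. ?w t * indicator {norm x..} t \<partial>lborel) * indicator (ball 0 s) x \<partial>(lborel::plane measure))"
  proof (subst emeasure_tip_energy)
    have "(\<integral>\<^sup>+t. ?w t * indicator {norm x..} t \<partial>lborel) = ennreal (1 / (2 * pi * norm x))" if "x \<noteq> 0" for x :: plane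
      using nn_integral_inverse_square[of "1 / (2 * pi)" "norm x"] that by simp
    note [simp] = this
    show "(\<integral>\<^sup>+x\<in>ball 0 s. ennreal (1 / (2 * pi * norm x)) \<partial>(lborel::plane measure)) =
      (\<integral>\<^sup>+x. (\<integral>\<^sup>+t. ?w t * indicator {norm x..} t \<partial>lborel) * indicator (ball 0 s) x \<partial>(lborel::plane measure))"
      by (intro nn_integral_cong_AE eventually_mono[OF nz]) (simp del: divide_divide_eq_left)
  qed simp
  also have "\<dots> = (\<integral>\<^sup>+x. (\<integral>\<^sup>+t. ?w t * (if norm x \<le> t \<and> norm x < s then 1 else 0) \<partial>lborel) \<partial>(lborel::plane measure))"
    by (intro nn_integral_cong) (auto simp: indicator_def of_bool_def)
  also have "\<dots> = (\<integral>\<^sup>+t. (\<integral>\<^sup>+x. ?w t * (if norm x \<le> t \<and> norm x < s then 1 else 0) \<partial>(lborel::plane measure)) \<partial>lborel)"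
    by (rule lborel_pair.Fubini') simp
  also have "\<dots> = (\<integral>\<^sup>+t. ?w t * emeasure lborel (cball 0 t \<inter> ball (0::plane) s) \<partial>lborel)"
  proof (intro nn_integral_cong)
    fix t :: real
    have "(\<integral>\<^sup>+x. ?w t * (if norm x \<le> t \<and> norm x < s then 1 else 0) \<partial>(lborel::plane measure))
      = (\<integral>\<^sup>+x. ?w t * indicator (cball 0 t \<inter> ball (0::plane) s) x \<partial>lborel)"
      by (intro nn_integral_cong) (auto simp: indicator_def of_bool_def)
    then show "(\<integral>\<^sup>+x. ?w t * (if norm x \<le> t \<and> norm x < s then 1 else 0) \<partial>(lborel::plane measure))
      = ?w t * emeasure lborel (cball 0 t \<inter> ball (0::plane) s)"
      by (simp add: nn_integral_cmult_indicator)
  qed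
  also have "\<dots> = (\<integral>\<^sup>+t. ennreal (1/2) * indicator {0<..<s} t + ennreal (s\<^sup>2 / 2 / t\<^sup>2) * indicator {s..} t \<partial>lborel)"
  proof (intro nn_integral_cong)
    fix t :: real
    consider "t \<le> 0" | "0 < t" "t < s" | "s \<le> t" by linarith
    then show "?w t * emeasure lborel (cball 0 t \<inter> ball (0::plane) s) =
      ennreal (1/2) * indicator {0<..<s} t + ennreal (s\<^sup>2 / 2 / t\<^sup>2) * indicator {s..} t"
    proof cases
      case 1
      then have "x = 0" if "norm x \<le> t" for x :: plane using that norm_le_zero_iff[of x] by linarith
      then have "cball 0 t \<inter> ball (0::plane) s \<subseteq> {0}" by auto
      then have "emeasure lborel (cball 0 t \<inter> ball (0::plane) s) \<le> emeasure lborel {0::plane}"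
        by (intro emeasure_mono) auto
      then show ?thesis using 1 s by simp
    next
      case 2
      then have "cball 0 t \<inter> ball (0::plane) s = cball 0 t" by auto
      then show ?thesis using 2
        by (simp add: emeasure_plane_cball field_simps flip: ennreal_mult)
    next
      case 3
      then have "cball 0 t \<inter> ball (0::plane) s = ball 0 s" by auto
      then show ?thesis using 3 s
        by (simp add: emeasure_plane_ball field_simps flip: ennreal_mult)
    qed
  qed
  also have "\<dots> = ennreal (1/2) * ennreal s + ennreal (s\<^sup>2 / 2 / s)"
    using s nn_integral_inverse_square[of "s\<^sup>2 / 2" s]
    by (subst nn_integral_add) (auto simp: nn_integral_cmult_indicator)
  also have "\<dots> = ennreal (1/2 * s + s\<^sup>2 / 2 / s)"
    using s by (subst ennreal_mult[symmetric], simp, simp, subst ennreal_plus) auto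
  also have "1/2 * s + s\<^sup>2 / 2 / s = s" using s by (simp add: power2_eq_square)
  finally show ?thesis .
qed

lemma tip_energy_null: "A \<in> null_sets lborel \<Longrightarrow> A \<in> null_sets tip_energy"
  by (auto simp: tip_energy_def null_sets_density_iff dest: AE_not_in elim: eventually_mono)

lemma emeasure_tip_energy_uminus:
  assumes A: "A \<in> sets borel"
  shows "emeasure tip_energy (uminus ` A) = emeasure tip_energy A"
proof -
  have eq: "lborel = (distr lborel borel uminus :: plane measure)"
    using lborel_affine[of "-1" "0 :: plane"] by (simp add: density_1)
  have im: "uminus ` A = uminus -` A" using bij_image_INT by force
  have [measurable]: "uminus ` A \<in> sets borel" 
    unfolding im by (rule measurable_sets_borel[OF _ A]) (rule borel_measurable_uminus, simp)
  have "emeasure tip_energy A = (\<integral>\<^sup>+x. ennreal (1 / (2 * pi * norm x)) * indicator A x \<partial>lborel)"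
    using A by (simp add: emeasure_tip_energy)
  also have "\<dots> = (\<integral>\<^sup>+x. ennreal (1 / (2 * pi * norm x)) * indicator A (- x) \<partial>lborel)"
    using A by (subst eq) (simp add: nn_integral_distr)
  also have "\<dots> = emeasure tip_energy (uminus ` A)"
    using \<open>uminus ` A \<in> sets borel\<close> by (subst emeasure_tip_energy) (auto simp: im indicator_def intro!: nn_integral_cong)
  finally show ?thesis ..
qed

text \<open>The reflection x \<mapsto> -x exchanges the two halves and preserves
  \<open>tip_energy\<close>, and the line between them is null.\<close>

lemma emeasure_tip_energy_half_balls:
  assumes s: "s > 0"
  shows "emeasure tip_energy {x \<in> ball 0 s. 0 < x$1} = ennreal (s / 2)"
    "emeasure tip_energy {x \<in> ball 0 s. x$1 < 0} = ennreal (s / 2)"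
proof -
  let ?P = "{x \<in> ball 0 s. 0 < x$1} :: plane set" and ?N = "{x \<in> ball 0 s. x$1 < 0} :: plane set"
    and ?Z = "{x \<in> ball 0 s. x$1 = 0} :: plane set"
  have m[measurable]: "?P \<in> sets borel" "?N \<in> sets borel" "?Z \<in> sets borel" by measurable
  have "{x::plane. x$1 = 0} \<in> null_sets lborel"
    using negligible_standard_hyperplane_cart[of 1]
    by (simp add: negligible_iff_null_sets null_sets_completion_iff)
  then have "?Z \<in> null_sets lborel" by (rule null_sets_subset) auto
  then have Z: "emeasure tip_energy ?Z = 0" using tip_energy_null by blast
  have "uminus ` ?P = ?N" by (auto intro!: image_eqI[of _ uminus "- _"])
  then have PN: "emeasure tip_energy ?N = emeasure tip_energy ?P"
    using emeasure_tip_energy_uminus[of ?P] by simp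
  have "ball 0 s = (?P \<union> ?N) \<union> ?Z" by auto
  then have "ennreal s = emeasure tip_energy ((?P \<union> ?N) \<union> ?Z)"
    using emeasure_tip_energy_ball[OF s] by metis
  also have "\<dots> = emeasure tip_energy (?P \<union> ?N) + emeasure tip_energy ?Z"
    by (rule plus_emeasure[symmetric]) auto
  also have "emeasure tip_energy (?P \<union> ?N) = emeasure tip_energy ?P + emeasure tip_energy ?N"
    by (rule plus_emeasure[symmetric]) auto
  finally have e: "ennreal s = 2 * emeasure tip_energy ?P" 
    by (simp only: Z PN mult_2 add_0_right)
  show "emeasure tip_energy ?P = ennreal (s / 2)"
  proof (cases "emeasure tip_energy ?P")
    case (real p)
    then have "ennreal s = ennreal (2 * p)" using e by (simp add: ennreal_mult)
    then show ?thesis using real s by (simp add: ennreal_inj)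
  qed (use e in simp)
  then show "emeasure tip_energy ?N = ennreal (s / 2)" by (simp only: PN)
qed

section \<open>Energy of discs centred away from the tip\<close>

lemma emeasure_tip_energy_ball_e1_le:
  assumes "r > 0"
  shows "emeasure tip_energy (ball (axis 1 1) r) \<le> ennreal (r + 1)"
proof -
  have "ball (axis 1 1) r \<subseteq> (ball 0 (r + 1) :: plane set)"
  proof
    fix x :: plane assume "x \<in> ball (axis 1 1) r"
    then show "x \<in> ball 0 (r + 1)"
      using norm_triangle_ineq[of "x - axis 1 1" "axis 1 1"] by (simp add: dist_norm norm_minus_commute)
  qed
  then have "emeasure tip_energy (ball (axis 1 1) r) \<le> emeasure tip_energy (ball 0 (r + 1))"
    by (intro emeasure_mono) auto
  then show ?thesis using assms by (simp add: emeasure_tip_energy_ball)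
qed

lemma emeasure_plane_box:
  assumes "a$1 \<le> b$1" "a$2 \<le> b$2"
  shows "emeasure lborel (box a (b::plane)) = ennreal ((b$1 - a$1) * (b$2 - a$2))"
proof -
  have "(\<Prod>i\<in>Basis. (b - a) \<bullet> i) = (b$1 - a$1) * (b$2 - a$2)"
    by (simp add: Basis_vec_def UNIV_2 axis_eq_axis inner_axis)
  moreover have "a \<bullet> i \<le> b \<bullet> i" if "i \<in> Basis" for i
    using that assms by (auto simp: Basis_vec_def UNIV_2 inner_axis)
  ultimately show ?thesis by simp
qed

text \<open>Splitting the disc at the vertical axis through the tip: the right half contains half of the
  disc of radius \<open>\<surd>(r\<^sup>2 - 1)\<close> about the tip, the left half contains half of the disc of radius
  \<open>r - 1\<close>. Together they fall short of \<open>r - 1/2\<close> by about \<open>1/(4r)\<close>, which a box outside the smaller disc makes up for.\<close>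

lemma emeasure_tip_energy_ball_e1_gt:
  "ennreal (199/2) < emeasure tip_energy (ball (axis 1 1) 100)"
proof -
  \<comment> \<open>A rational number just below sqrt(100^2 - 1). The two half discs then give
    49.997 + 49.5 = 99.497, which misses 99.5 by 0.003.\<close>
  define a :: real where "a = 99.994"
  let ?P = "{x \<in> ball 0 a. 0 < x$1} :: plane set" and ?N = "{x \<in> ball 0 99. x$1 < 0} :: plane set"
  \<comment> \<open>The box lies above the disc of radius 99 and fits into the large disc, since
    10^2 + 99.4^2 < 100^2. Its area is 9 * 0.4 = 3.6. Its points are nearer to the tip than to e1,
    so their norm is below 100 and the density is at least 1/800; the box contributes at least
    0.0045 > 0.003.\<close>
  define Q :: "plane set" where "Q = box (vector [-9, 99]) (vector [0, 99.4])"
  have Q: "x \<in> Q \<longleftrightarrow> -9 < x$1 \<and> x$1 < 0 \<and> 99 < x$2 \<and> x$2 < 99.4" for x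
    by (auto simp: Q_def mem_box_cart forall_2)
  have m[measurable]: "?P \<in> sets borel" "?N \<in> sets borel" "Q \<in> sets borel" by (simp_all add: Q_def)
  have b: "x \<in> ball (axis 1 1) r \<longleftrightarrow> (x$1 - 1)\<^sup>2 + (x$2)\<^sup>2 < r\<^sup>2" if "r > 0" for x :: plane and r
    using that real_sqrt_less_iff[of _ "r\<^sup>2"]
    by (simp add: dist_norm norm_plane axis_def power2_commute)
  have z: "x \<in> ball 0 r \<longleftrightarrow> (x$1)\<^sup>2 + (x$2)\<^sup>2 < r\<^sup>2" if "r > 0" for x :: plane and r
    using that real_sqrt_less_iff[of _ "r\<^sup>2"] by (simp add: norm_plane)
  have PN: "?P \<union> ?N \<union> Q \<subseteq> ball (axis 1 1) 100"
  proof
    fix x assume "x \<in> ?P \<union> ?N \<union> Q"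
    then consider "x \<in> ?P" | "x \<in> ?N" | "x \<in> Q" by blast
    then show "x \<in> ball (axis 1 1) 100"
    proof cases
      case 1
      then have "(x$1)\<^sup>2 + (x$2)\<^sup>2 < a\<^sup>2" "0 < x$1" using z[of a x] by (simp_all add: a_def)
      then show ?thesis using b[of 100 x] by (simp add: a_def power2_diff power_divide)
    next
      case 2
      then have "norm x < 99" by simp
      then show ?thesis
        using norm_triangle_ineq4[of x "axis 1 1"] by (simp add: dist_norm norm_minus_commute)
    next
      case 3
      then have "(1 - x$1)\<^sup>2 < 10\<^sup>2" "(x$2)\<^sup>2 < 99.4\<^sup>2" using Q by (intro power_strict_mono; simp)+
      then have "(x$1 - 1)\<^sup>2 + (x$2)\<^sup>2 < 10\<^sup>2 + 99.4\<^sup>2"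
        unfolding power2_commute[of "x$1"] by (rule add_strict_mono)
      also have "\<dots> < 100\<^sup>2" by (simp add: power_divide)
      finally show ?thesis using b[of 100 x] by simp
    qed
  qed
  have Qe: "ennreal (36/8000) \<le> emeasure tip_energy Q"
  proof -
    have "ennreal (1/800) * indicator Q x \<le> ennreal (1 / (2 * pi * norm x)) * indicator Q x" for x
    proof (cases "x \<in> Q")
      case True
      then have "x \<in> ball (axis 1 1) 100" using PN by blast
      moreover have "(x$1)\<^sup>2 \<le> (x$1 - 1)\<^sup>2" using True Q by (simp add: power2_diff)
      ultimately have "x \<in> ball 0 100" using b[of 100 x] z[of 100 x] by linarith
      then have n: "norm x \<le> 100" by simp
      moreover have "0 < norm x" using True Q by auto
      moreover have "2 * pi * norm x \<le> (2 * 4) * 100"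
        using n pi_less_4 by (intro mult_mono) auto
      ultimately have "1 / 800 \<le> 1 / (2 * pi * norm x)"
        by (intro divide_left_mono) auto
      then show ?thesis using True by (simp add: ennreal_leI)
    qed simp
    then have "(\<integral>\<^sup>+x. ennreal (1/800) * indicator Q x \<partial>lborel) \<le> emeasure tip_energy Q"
      using m by (simp add: emeasure_tip_energy nn_integral_mono)
    moreover have "emeasure lborel Q = ennreal (36/10)"
      unfolding Q_def by (subst emeasure_plane_box) simp_all
    then have "(\<integral>\<^sup>+x. ennreal (1/800) * indicator Q x \<partial>lborel) = ennreal (36/8000)"
      using m by (simp add: nn_integral_cmult_indicator flip: ennreal_mult)
    ultimately show ?thesis by simp
  qed
  have "ennreal (199/2) < ennreal (a/2 + 99/2 + 36/8000)"
    by (intro ennreal_lessI) (auto simp: a_def)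
  also have "\<dots> = ennreal (a/2) + ennreal (99/2) + ennreal (36/8000)"
    by (simp add: a_def flip: ennreal_plus)
  also have "\<dots> \<le> emeasure tip_energy ?P + emeasure tip_energy ?N + emeasure tip_energy Q"
    using emeasure_tip_energy_half_balls[of a] emeasure_tip_energy_half_balls[of 99] Qe
    by (intro add_mono) (auto simp: a_def)
  also have "\<dots> = emeasure tip_energy (?P \<union> ?N) + emeasure tip_energy Q"
    by (intro arg_cong2[where f="(+)"] plus_emeasure) auto
  also have "\<dots> = emeasure tip_energy (?P \<union> ?N \<union> Q)"
  proof (rule plus_emeasure)
    have "x \<notin> ?N" if "x \<in> Q" for x
    proof -
      have "99 < \<bar>x$2\<bar>" using that Q by auto
      then have "99 < norm x" using component_le_norm_cart[of x 2] by linarith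
      then show ?thesis by auto
    qed
    then show "(?P \<union> ?N) \<inter> Q = {}" using Q by fastforce
  qed auto
  also have "\<dots> \<le> emeasure tip_energy (ball (axis 1 1) 100)"
    using PN by (intro emeasure_mono) auto
  finally show ?thesis .
qed

section \<open>Uniqueness of the absolutely continuous gradient\<close>

definition C1 :: "(plane \<Rightarrow> real) \<Rightarrow> bool" where
  "C1 f \<longleftrightarrow> (\<exists>f'. (\<forall>x. (f has_derivative f' x) (at x)) \<and> (\<forall>v. continuous_on UNIV (\<lambda>x. f' x v)))"

lemma C1_continuous: "C1 f \<Longrightarrow> continuous_on UNIV f"
  by (auto simp: C1_def continuous_on_eq_continuous_at intro: has_derivative_continuous)

lemma C1_mult:
  assumes "C1 f" "C1 g"
  shows "C1 (\<lambda>x. f x * g x)"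
proof -
  obtain f' g' where d: "\<And>x. (f has_derivative f' x) (at x)" "\<And>v. continuous_on UNIV (\<lambda>x. f' x v)"
    "\<And>x. (g has_derivative g' x) (at x)" "\<And>v. continuous_on UNIV (\<lambda>x. g' x v)"
    using assms unfolding C1_def by metis
  note C1_continuous[OF assms(1), continuous_intros] C1_continuous[OF assms(2), continuous_intros]
  show ?thesis unfolding C1_def
    by (intro exI[of _ "\<lambda>x v. f x * g' x v + f' x v * g x"] conjI allI has_derivative_mult d continuous_intros)
qed

lemma C1_compose:
  assumes "C1 f" and h: "\<And>t. (h has_real_derivative h' t) (at t)" "continuous_on UNIV h'"
  shows "C1 (\<lambda>x. h (f x))"
proof -
  obtain f' where d: "\<And>x. (f has_derivative f' x) (at x)" "\<And>v. continuous_on UNIV (\<lambda>x. f' x v)"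
    using assms unfolding C1_def by metis
  have "((\<lambda>x. h (f x)) has_derivative (\<lambda>v. h' (f x) * f' x v)) (at x)" for x
    using has_derivative_compose[OF d(1) h(1)[unfolded has_field_derivative_def]] by simp
  moreover have "continuous_on UNIV (\<lambda>x. h' (f x) * f' x v)" for v
    by (intro continuous_on_mult d continuous_on_compose2[OF h(2) C1_continuous[OF assms(1)]]) auto
  ultimately show ?thesis unfolding C1_def by (intro exI[of _ "\<lambda>x v. h' (f x) * f' x v"]) auto
qed

lemma C1_nth: "C1 (\<lambda>x. x $ i)"
  unfolding C1_def
  by (intro exI[of _ "\<lambda>x v. v $ i"]) (auto intro: bounded_linear.has_derivative bounded_linear_vec_nth)

lemma C1_compact_supportI:
  assumes "C1 f" "{x. f x \<noteq> 0} \<subseteq> box a b"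
  shows "f \<in> C1_compact_support UNIV"
proof -
  obtain f' where d: "\<And>x. (f has_derivative f' x) (at x)" "\<And>v. continuous_on UNIV (\<lambda>x. f' x v)"
    using assms unfolding C1_def by metis
  have "partial_deriv i f = (\<lambda>x. f' x (axis i 1))" for i
    by (simp add: partial_deriv_def fun_eq_iff frechet_derivative_at[OF d(1), symmetric])
  moreover have "bounded {x. f x \<noteq> 0}" using assms(2) bounded_box bounded_subset by blast
  ultimately show ?thesis
    using d by (auto simp: C1_compact_support_def differentiable_def compact_closure)
qed

text \<open>Each squared positive part is continuously differentiable and positive exactly on its
  half-plane, so the product is positive exactly on the open box. Its size is immaterial, since the
  cutoff below only needs to see where it vanishes.\<close>

definition box_profile :: "plane \<Rightarrow> plane \<Rightarrow> plane \<Rightarrow> real" where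
  "box_profile a b x = (max 0 (x$1 - a$1))\<^sup>2 * (max 0 (b$1 - x$1))\<^sup>2 *
     ((max 0 (x$2 - a$2))\<^sup>2 * (max 0 (b$2 - x$2))\<^sup>2)"

text \<open>Equals n q^2 / (1 + n q^2) for the profile q: a smooth function of q with values in [0,
  1), tending to 1 where q is nonzero and identically 0 elsewhere.\<close>

definition box_cutoff :: "plane \<Rightarrow> plane \<Rightarrow> nat \<Rightarrow> plane \<Rightarrow> real" where
  "box_cutoff a b n x = 1 - 1 / (1 + real n * (box_profile a b x)\<^sup>2)"

text \<open>Squaring removes the corner of the positive part: at 0 the difference quotient is
  bounded by \<bar>h\<bar>.\<close>

lemma has_real_derivative_max_square:
  "((\<lambda>t. (max 0 t)\<^sup>2) has_real_derivative 2 * max 0 t) (at t)" for t :: real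
proof (cases "t = 0")
  case True
  have "((\<lambda>h::real. (max 0 h)\<^sup>2 / h) \<longlongrightarrow> 0) (at 0)"
  proof (rule Lim_null_comparison)
    show "\<forall>\<^sub>F h in at 0. norm ((max 0 h)\<^sup>2 / h) \<le> \<bar>h\<bar>"
      by (rule always_eventually) (auto simp: max_def power2_eq_square)
    show "((\<lambda>h::real. \<bar>h\<bar>) \<longlongrightarrow> 0) (at 0)" by (rule tendsto_rabs_zero) simp
  qed
  then show ?thesis using True by (simp add: DERIV_def)
next
  case False
  then consider "t > 0" | "t < 0" by linarith
  then show ?thesis
  proof cases
    case 1
    have "((\<lambda>t. t\<^sup>2) has_real_derivative 2 * max 0 t) (at t)"
      using 1 by (auto intro!: derivative_eq_intros)
    then show ?thesis
      by (rule has_field_derivative_transform_within_open[where S = "{0<..}"]) (use 1 in auto)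
  next
    case 2
    have "((\<lambda>t. 0) has_real_derivative 2 * max 0 t) (at t)"
      using 2 by (auto intro!: derivative_eq_intros)
    then show ?thesis
      by (rule has_field_derivative_transform_within_open[where S = "{..<0}"]) (use 2 in auto)
  qed
qed

lemma C1_box_profile: "C1 (box_profile a b)"
proof -
  have "((\<lambda>t. (max 0 (t - c))\<^sup>2) has_real_derivative 2 * max 0 (t - c)) (at t)" for t c :: real
  proof -
    have "((\<lambda>t. t - c) has_real_derivative 1) (at t)" by (auto intro!: derivative_eq_intros)
    from DERIV_chain2[OF has_real_derivative_max_square this] show ?thesis by simp
  qed
  moreover have "continuous_on UNIV (\<lambda>t. 2 * max 0 (t - c))" for c :: real
    by (intro continuous_on_mult continuous_on_max continuous_on_diff continuous_on_const continuous_on_id)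
  ultimately have *: "C1 (\<lambda>x. (max 0 (x$i - c))\<^sup>2)" for c i
    by (rule C1_compose[OF C1_nth])
  have "((\<lambda>t. (max 0 (c - t))\<^sup>2) has_real_derivative - 2 * max 0 (c - t)) (at t)" for t c :: real
  proof -
    have "((\<lambda>t. c - t) has_real_derivative -1) (at t)" by (auto intro!: derivative_eq_intros)
    from DERIV_chain2[OF has_real_derivative_max_square this] show ?thesis by simp
  qed
  moreover have "continuous_on UNIV (\<lambda>t. - 2 * max 0 (c - t))" for c :: real
    by (intro continuous_on_mult continuous_on_max continuous_on_diff continuous_on_const continuous_on_id)
  ultimately have "C1 (\<lambda>x. (max 0 (c - x$i))\<^sup>2)" for c i
    by (rule C1_compose[OF C1_nth])
  with * show ?thesis
    unfolding box_profile_def[abs_def] by (intro C1_mult)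
qed

lemma box_profile_nonzero_iff: "box_profile a b x \<noteq> 0 \<longleftrightarrow> x \<in> box a b"
  by (auto simp: box_profile_def mem_box_cart forall_2 max_def)

lemma box_cutoff_test: "box_cutoff a b n \<in> C1_compact_support UNIV"
proof (rule C1_compact_supportI)
  have pos: "1 + real n * t\<^sup>2 > 0" for t :: real by (intro add_pos_nonneg) auto
  have "((\<lambda>t. 1 - 1 / (1 + real n * t\<^sup>2)) has_real_derivative 2 * real n * t / (1 + real n * t\<^sup>2)\<^sup>2) (at t)" for t
    using pos[of t] by (auto intro!: derivative_eq_intros simp: power2_eq_square)
  moreover have "continuous_on UNIV (\<lambda>t. 2 * real n * t / (1 + real n * t\<^sup>2)\<^sup>2)"
    using pos by (intro continuous_intros) (auto simp: less_imp_neq[symmetric])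
  ultimately show "C1 (box_cutoff a b n)"
    unfolding box_cutoff_def[abs_def] by (intro C1_compose[OF C1_box_profile])
  show "{x. box_cutoff a b n x \<noteq> 0} \<subseteq> box a b"
  proof (intro subsetI, elim CollectE)
    fix x assume "box_cutoff a b n x \<noteq> 0"
    then have "box_profile a b x \<noteq> 0" by (auto simp: box_cutoff_def)
    then show "x \<in> box a b" by (simp only: box_profile_nonzero_iff)
  qed
qed

lemma box_cutoff_bounds: "0 \<le> box_cutoff a b n x" "box_cutoff a b n x \<le> indicator (box a b) x"
proof -
  have pos: "1 + real n * t\<^sup>2 \<ge> 1" for t :: real by simp
  have "1 / (1 + real n * (box_profile a b x)\<^sup>2) \<le> 1"
    using pos[of "box_profile a b x"] by (intro divide_le_eq_1[THEN iffD2]) linarith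
  then show "0 \<le> box_cutoff a b n x" by (simp add: box_cutoff_def)
  show "box_cutoff a b n x \<le> indicator (box a b) x"
    using box_profile_nonzero_iff[of a b x] by (cases "x \<in> box a b") (auto simp: box_cutoff_def)
qed

lemma box_cutoff_tendsto: "(\<lambda>n. box_cutoff a b n x) \<longlonglongrightarrow> indicator (box a b) x"
proof (cases "x \<in> box a b")
  case True
  define c where "c = (box_profile a b x)\<^sup>2"
  have c: "c > 0" using True box_profile_nonzero_iff[of a b x] by (simp add: c_def)
  have "filterlim (\<lambda>n. 1 + real n * c) at_top sequentially"
    using c by (intro filterlim_tendsto_add_at_top[OF tendsto_const] filterlim_at_top_mult_tendsto_pos[OF tendsto_const] filterlim_real_sequentially)
  then have "(\<lambda>n. 1 / (1 + real n * c)) \<longlonglongrightarrow> 0"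
    by (intro tendsto_divide_0[OF tendsto_const] filterlim_at_top_imp_at_infinity)
  then have "(\<lambda>n. 1 - 1 / (1 + real n * c)) \<longlonglongrightarrow> 1 - 0" by (intro tendsto_intros)
  then show ?thesis using True by (simp add: box_cutoff_def c_def)
next
  case False
  then show ?thesis using box_profile_nonzero_iff[of a b x] by (simp add: box_cutoff_def)
qed

lemma test_function_continuous:
  assumes "\<phi> \<in> C1_compact_support UNIV"
  shows "continuous_on UNIV \<phi>" "continuous_on UNIV (partial_deriv i \<phi>)"
  using assms
  by (auto simp: C1_compact_support_def differentiable_on_def differentiable_at_withinI
      intro!: differentiable_imp_continuous_on)

lemma borel_measurable_box_cutoff[measurable]: "box_cutoff a b n \<in> borel_measurable borel"
  by (intro borel_measurable_continuous_onI test_function_continuous box_cutoff_test)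

text \<open>Dominated convergence, for a general Borel measure because it is applied to Lebesgue
  measure and to both singular measures.\<close>

lemma box_cutoff_integral_tendsto:
  fixes f :: "plane \<Rightarrow> real"
  assumes M[measurable_cong]: "sets M = sets borel" and [measurable]: "f \<in> borel_measurable borel"
    and int: "integrable M (\<lambda>x. indicator (box a b) x * f x)"
  shows "(\<lambda>n. \<integral>x. box_cutoff a b n x * f x \<partial>M) \<longlonglongrightarrow> (\<integral>x. indicator (box a b) x * f x \<partial>M)"
proof (rule integral_dominated_convergence)
  show "integrable M (\<lambda>x. \<bar>indicator (box a b) x * f x\<bar>)" using int by (rule integrable_abs)
  show "AE x in M. (\<lambda>n. box_cutoff a b n x * f x) \<longlonglongrightarrow> indicator (box a b) x * f x"
    by (intro AE_I2 tendsto_mult box_cutoff_tendsto tendsto_const)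
  show "AE x in M. norm (box_cutoff a b n x * f x) \<le> \<bar>indicator (box a b) x * f x\<bar>" for n
    using box_cutoff_bounds[of a b n] by (intro AE_I2) (auto simp: abs_mult intro!: mult_right_mono)
qed measurable

section \<open>Countably additive real set functions determined by boxes\<close>

lemma sums_integral_indicator:
  fixes f :: "'a \<Rightarrow> real"
  assumes int: "integrable M f" and A[measurable]: "\<And>i. A i \<in> sets M" and disj: "disjoint_family A"
  shows "(\<lambda>i. \<integral>x. indicator (A i) x * f x \<partial>M) sums (\<integral>x. indicator (\<Union>i. A i) x * f x \<partial>M)"
proof -
  have [measurable]: "f \<in> borel_measurable M" using int by simp
  have i: "integrable M (\<lambda>x. indicator (A i) x * f x)" for i
    using integrable_mult_indicator[OF A int] by simp
  have s: "(\<lambda>i. indicator (A i) x :: real) sums indicator (\<Union>i. A i) x" for x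
    using disj by (intro indicator_sums) (auto simp: disjoint_family_on_def)
  have "(\<lambda>n. \<integral>x. (\<Sum>i<n. indicator (A i) x) * f x \<partial>M) \<longlonglongrightarrow> (\<integral>x. indicator (\<Union>i. A i) x * f x \<partial>M)"
  proof (rule integral_dominated_convergence)
    show "integrable M (\<lambda>x. \<bar>f x\<bar>)" using int by (rule integrable_abs)
    show "AE x in M. (\<lambda>n. (\<Sum>i<n. indicator (A i) x) * f x) \<longlonglongrightarrow> indicator (\<Union>i. A i) x * f x"
      using s by (intro AE_I2 tendsto_mult tendsto_const) (simp add: sums_def)
    show "AE x in M. norm ((\<Sum>i<n. indicator (A i) x) * f x) \<le> \<bar>f x\<bar>" for n
    proof (intro AE_I2)
      fix x
      have "(\<Sum>i<n. indicator (A i) x :: real) \<le> indicator (\<Union>i. A i) x"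
        using sum_le_suminf[OF sums_summable[OF s], of "{..<n}" x] by (simp add: sums_unique[OF s, symmetric])
      also have "\<dots> \<le> 1" by (rule indicator_le_1)
      finally have "(\<Sum>i<n. indicator (A i) x :: real) \<le> 1" .
      then show "norm ((\<Sum>i<n. indicator (A i) x) * f x) \<le> \<bar>f x\<bar>"
        by (simp add: abs_mult sum_nonneg mult_left_le_one_le)
    qed
  qed measurable
  moreover have "(\<Sum>i<n. \<integral>x. indicator (A i) x * f x \<partial>M) = (\<integral>x. (\<Sum>i<n. indicator (A i) x) * f x \<partial>M)" for n
    using i by (simp only: sum_distrib_right Bochner_Integration.integral_sum)
  ultimately show ?thesis by (simp only: sums_def)
qed

text \<open>A Dynkin class argument for a set function that may take both signs: boxes form an
  intersection-stable generator of the Borel sets. The total value 0 is what makes complements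
  work.\<close>

lemma additive_zero_if_zero_on_boxes:
  fixes T :: "'a::euclidean_space set \<Rightarrow> real"
  assumes sums: "\<And>A. disjoint_family A \<Longrightarrow> (\<And>i::nat. A i \<in> sets borel) \<Longrightarrow> (\<lambda>i. T (A i)) sums T (\<Union>i. A i)"
    and zero: "T {} = 0" "T UNIV = 0" "\<And>a b. T (box a b) = 0" and S: "S \<in> sets borel"
  shows "T S = 0"
proof -
  let ?G = "range (\<lambda>(a, b). box a b :: 'a set)"
  have borel: "sets borel = sigma_sets UNIV ?G"
    by (subst borel_eq_box) (simp add: sets_measure_of)
  have "Int_stable ?G"
    by (auto simp: Int_stable_def box_Int_box)
  moreover have "?G \<subseteq> Pow UNIV" by simp
  moreover have "S \<in> sigma_sets UNIV ?G" using S borel by simp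
  ultimately show ?thesis
  proof (induction rule: sigma_sets_induct_disjoint)
    case (compl A)
    \<comment> \<open>Additivity is assumed for sequences only; padding with empty sets, where
      \<open>T\<close> vanishes, yields it for \<open>A\<close> and its complement.\<close>
    let ?A = "\<lambda>i::nat. if i = 0 then A else if i = 1 then - A else {}"
    have A: "A \<in> sets borel" using compl borel by simp
    have "disjoint_family ?A" by (auto simp: disjoint_family_on_def)
    moreover have "?A i \<in> sets borel" for i using A by (auto simp: Compl_in_sets_lebesgue)
    ultimately have s: "(\<lambda>i. T (?A i)) sums T (\<Union>i. ?A i)" by (rule sums)
    have "x \<in> (\<Union>i. ?A i)" for x
      by (cases "x \<in> A") (auto intro: UN_I[of 0] UN_I[of 1])
    then have "(\<Union>i. ?A i) = UNIV" by blast
    with s have s: "(\<lambda>i. T (?A i)) sums T UNIV" by (simp only:)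
    have "(\<lambda>i. T (?A i)) sums (\<Sum>i<2. T (?A i))"
      by (rule sums_finite) (auto simp: zero)
    with s have "T UNIV = (\<Sum>i<2. T (?A i))" by (rule sums_unique2)
    then show ?case using compl zero by (simp add: numeral_2_eq_2 Compl_eq_Diff_UNIV)
  next
    case (union A)
    then have "(\<lambda>i. T (A i)) sums T (\<Union>i. A i)" using borel by (intro sums) auto
    then show ?case using union sums_unique2[OF _ sums_zero] by simp
  qed (auto simp: zero)
qed

lemma borel_measurable_vec_nth[measurable (raw)]:
  fixes f :: "'a \<Rightarrow> real^'n"
  assumes "f \<in> borel_measurable M"
  shows "(\<lambda>x. f x $ i) \<in> borel_measurable M"
  using assms by (rule measurable_compose) (intro borel_measurable_continuous_onI continuous_intros)

lemma derivative_decomposition_test: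
  assumes "derivative_decomposition UNIV u g \<sigma> \<mu>" "\<phi> \<in> C1_compact_support UNIV"
  shows "(\<integral>x. u x * partial_deriv i \<phi> x \<partial>lebesgue) =
    - (\<integral>x. \<phi> x * g x $ i \<partial>lebesgue) - (\<integral>x. \<phi> x * \<sigma> x $ i \<partial>\<mu>)"
  using assms by (simp add: derivative_decomposition_def)

lemma derivative_decomposition_integrable_ac:
  assumes "derivative_decomposition UNIV u g \<sigma> \<mu>"
  shows "integrable lborel (\<lambda>x. indicator (box a b) x * g x $ i)"
proof -
  have [measurable]: "g \<in> borel_measurable borel" and "set_integrable lebesgue (cbox a b) g"
    using assms by (auto simp: derivative_decomposition_def locally_integrable_def)
  then have "integrable lborel (\<lambda>x. indicator (cbox a b) x *\<^sub>R g x)"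
    by (simp add: set_integrable_def integrable_completion)
  then have "integrable lborel (\<lambda>x. (indicator (cbox a b) x *\<^sub>R g x) $ i)"
    by (rule integrable_bounded_linear[OF bounded_linear_vec_nth])
  then show ?thesis
    by (rule Bochner_Integration.integrable_bound)
       (auto simp: indicator_def dest: subsetD[OF box_subset_cbox])
qed

lemma derivative_decomposition_integrable_singular:
  assumes "derivative_decomposition UNIV u g \<sigma> \<mu>"
  shows "integrable \<mu> (\<lambda>x. indicator (box a b) x * \<sigma> x $ i)"
proof -
  have [measurable]: "\<sigma> \<in> borel_measurable borel" and [measurable_cong]: "sets \<mu> = sets borel"
    and fin: "emeasure \<mu> (cbox a b) < \<infinity>" and ae: "AE x in \<mu>. norm (\<sigma> x) = 1"
    using assms by (auto simp: derivative_decomposition_def)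
  have "integrable \<mu> (indicator (cbox a b) :: _ \<Rightarrow> real)"
    using fin by (simp add: integrable_indicator_iff)
  then show ?thesis
  proof (rule Bochner_Integration.integrable_bound)
    show "AE x in \<mu>. norm (indicator (box a b) x * \<sigma> x $ i) \<le> norm (indicator (cbox a b) x :: real)"
      using ae
    proof eventually_elim
      case (elim x)
      then have "\<bar>\<sigma> x $ i\<bar> \<le> 1" using component_le_norm_cart[of "\<sigma> x" i] by simp
      then show ?case by (auto simp: indicator_def dest: subsetD[OF box_subset_cbox])
    qed
  qed measurable
qed

text \<open>Testing against cutoffs converging to indicators of boxes turns the distributional identities into
  equality of two countably additive set functions on boxes, hence on Borel sets; removing the null sets
  that carry the singular parts leaves only the densities.\<close>

lemma derivative_decomposition_unique:
  assumes d: "derivative_decomposition UNIV u g \<sigma> \<mu>" and d': "derivative_decomposition UNIV u g' \<sigma>' \<mu>'"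
  shows "AE x in lborel. g x = g' x"
proof -
  have [measurable]: "g \<in> borel_measurable borel" "g' \<in> borel_measurable borel"
    "\<sigma> \<in> borel_measurable borel" "\<sigma>' \<in> borel_measurable borel"
    and [measurable_cong]: "sets \<mu> = sets borel" "sets \<mu>' = sets borel"
    using d d' by (auto simp: derivative_decomposition_def)
  obtain N N' where N: "N \<in> null_sets lborel" "AE x in \<mu>. x \<in> N" and N': "N' \<in> null_sets lborel" "AE x in \<mu>'. x \<in> N'"
    using d d' by (auto simp: derivative_decomposition_def)
  have [measurable]: "N \<in> sets borel" "N' \<in> sets borel" using N N' by auto
  have test: "(\<integral>x. \<phi> x * g x $ i \<partial>lborel) + (\<integral>x. \<phi> x * \<sigma> x $ i \<partial>\<mu>) =
      (\<integral>x. \<phi> x * g' x $ i \<partial>lborel) + (\<integral>x. \<phi> x * \<sigma>' x $ i \<partial>\<mu>')"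
    if \<phi>: "\<phi> \<in> C1_compact_support UNIV" and [measurable]: "\<phi> \<in> borel_measurable borel" for \<phi> i
  proof -
    have "- (\<integral>x. \<phi> x * g x $ i \<partial>lebesgue) - (\<integral>x. \<phi> x * \<sigma> x $ i \<partial>\<mu>) =
      - (\<integral>x. \<phi> x * g' x $ i \<partial>lebesgue) - (\<integral>x. \<phi> x * \<sigma>' x $ i \<partial>\<mu>')"
      using derivative_decomposition_test[OF d \<phi>, of i] derivative_decomposition_test[OF d' \<phi>, of i] by simp
    then show ?thesis by (simp add: integral_completion)
  qed
  have box: "(\<integral>x. indicator (box a b) x * g x $ i \<partial>lborel) + (\<integral>x. indicator (box a b) x * \<sigma> x $ i \<partial>\<mu>) =
      (\<integral>x. indicator (box a b) x * g' x $ i \<partial>lborel) + (\<integral>x. indicator (box a b) x * \<sigma>' x $ i \<partial>\<mu>')" for a b i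
  proof (rule LIMSEQ_unique)
    have [simp]: "(\<lambda>x. g x $ i) \<in> borel_measurable borel" "(\<lambda>x. \<sigma> x $ i) \<in> borel_measurable borel"
      "(\<lambda>x. g' x $ i) \<in> borel_measurable borel" "(\<lambda>x. \<sigma>' x $ i) \<in> borel_measurable borel"
      by measurable
    have [simp]: "sets \<mu> = sets borel" "sets \<mu>' = sets borel"
      using d d' by (auto simp: derivative_decomposition_def)
    show "(\<lambda>n. (\<integral>x. box_cutoff a b n x * g x $ i \<partial>lborel) + (\<integral>x. box_cutoff a b n x * \<sigma> x $ i \<partial>\<mu>)) \<longlonglongrightarrow>
      (\<integral>x. indicator (box a b) x * g x $ i \<partial>lborel) + (\<integral>x. indicator (box a b) x * \<sigma> x $ i \<partial>\<mu>)"
      by (intro tendsto_add box_cutoff_integral_tendsto derivative_decomposition_integrable_ac[OF d]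
          derivative_decomposition_integrable_singular[OF d]) simp_all
    show "(\<lambda>n. (\<integral>x. box_cutoff a b n x * g x $ i \<partial>lborel) + (\<integral>x. box_cutoff a b n x * \<sigma> x $ i \<partial>\<mu>)) \<longlonglongrightarrow>
      (\<integral>x. indicator (box a b) x * g' x $ i \<partial>lborel) + (\<integral>x. indicator (box a b) x * \<sigma>' x $ i \<partial>\<mu>')"
      unfolding test[OF box_cutoff_test borel_measurable_box_cutoff]
      by (intro tendsto_add box_cutoff_integral_tendsto derivative_decomposition_integrable_ac[OF d']
          derivative_decomposition_integrable_singular[OF d']) simp_all
  qed
  have zero: "AE x in lborel. indicator (box a b) x * (g x $ i - g' x $ i) = 0" for a b i
  proof (rule sigma_finite_measure.density_zero[OF sigma_finite_lborel])
    \<comment> \<open>\<open>g\<close> and \<open>g'\<close> are only locally integrable and the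
      singular measures only locally finite; restricting everything to one fixed box makes
      \<open>T\<close> a finite set function on all Borel sets.\<close>
    let ?I = "indicator (box a b) :: plane \<Rightarrow> real"
    note ig = derivative_decomposition_integrable_ac[OF d, of a b i]
      derivative_decomposition_integrable_ac[OF d', of a b i]
      and im = derivative_decomposition_integrable_singular[OF d, of a b i]
      derivative_decomposition_integrable_singular[OF d', of a b i]
    have ih: "integrable lborel (\<lambda>x. ?I x * (g x $ i - g' x $ i))"
      using Bochner_Integration.integrable_diff[OF ig] by (simp add: right_diff_distrib)
    then show "integrable lborel (\<lambda>x. ?I x * (g x $ i - g' x $ i))" .
    define T where "T S = (\<integral>x. indicator S x * (?I x * g x $ i) \<partial>lborel) + (\<integral>x. indicator S x * (?I x * \<sigma> x $ i) \<partial>\<mu>)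
      - (\<integral>x. indicator S x * (?I x * g' x $ i) \<partial>lborel) - (\<integral>x. indicator S x * (?I x * \<sigma>' x $ i) \<partial>\<mu>')" for S
    \<comment> \<open>Boxes intersect in boxes, so the restricted \<open>T\<close> on a box is an
      instance of the identity already obtained for boxes.\<close>
    have boxI: "indicator (box c e) x * (?I x * t) = indicator (box (\<chi> k. max (c$k) (a$k)) (\<chi> k. min (e$k) (b$k))) x * t" for c e x t
      by (auto simp: indicator_def mem_box_cart)
    have T0: "T S = 0" if "S \<in> sets borel" for S
    proof (rule additive_zero_if_zero_on_boxes[OF _ _ _ _ that])
      show "T (box c e) = 0" for c e
        using box[of "\<chi> k. max (c$k) (a$k)" "\<chi> k. min (e$k) (b$k)" i] unfolding T_def boxI by simp
      show "T UNIV = 0" using box[of a b i] by (simp add: T_def)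
      show "T {} = 0" by (simp add: T_def)
      show "(\<lambda>i. T (A i)) sums T (\<Union>i. A i)" if "disjoint_family A" "\<And>i. A i \<in> sets borel" for A :: "nat \<Rightarrow> plane set"
        unfolding T_def using that
        by (intro sums_add sums_diff sums_integral_indicator ig im) auto
    qed
    fix S :: "plane set" assume "S \<in> sets lborel"
    then have [measurable]: "S \<in> sets borel" by simp
    define S' where "S' = S - (N \<union> N')"
    have [measurable]: "S' \<in> sets borel" by (simp add: S'_def)
    have "(\<integral>x. indicator S' x * (?I x * \<sigma> x $ i) \<partial>\<mu>) = (\<integral>x. 0 \<partial>\<mu>)"
      using N(2) by (intro integral_cong_AE) (auto elim!: eventually_mono simp: S'_def)
    moreover have "(\<integral>x. indicator S' x * (?I x * \<sigma>' x $ i) \<partial>\<mu>') = (\<integral>x. 0 \<partial>\<mu>')"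
      using N'(2) by (intro integral_cong_AE) (auto elim!: eventually_mono simp: S'_def)
    ultimately have "(\<integral>x. indicator S' x * (?I x * g x $ i) \<partial>lborel) - (\<integral>x. indicator S' x * (?I x * g' x $ i) \<partial>lborel) = 0"
      using T0[of S'] by (simp add: T_def)
    moreover have "integrable lborel (\<lambda>x. indicator S' x * (?I x * g x $ i))" "integrable lborel (\<lambda>x. indicator S' x * (?I x * g' x $ i))"
      using integrable_mult_indicator[OF _ ig(1), of S'] integrable_mult_indicator[OF _ ig(2), of S']
      by simp_all
    ultimately have "(\<integral>x. indicator S' x * (?I x * (g x $ i - g' x $ i)) \<partial>lborel) = 0"
      by (simp add: right_diff_distrib)
    moreover have "(\<integral>x. indicator S x * (?I x * (g x $ i - g' x $ i)) \<partial>lborel) =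
        (\<integral>x. indicator S' x * (?I x * (g x $ i - g' x $ i)) \<partial>lborel)"
      using AE_not_in[OF N(1)] AE_not_in[OF N'(1)]
      by (intro integral_cong_AE) (auto elim!: eventually_elim2 simp: S'_def indicator_def)
    ultimately show "set_lebesgue_integral lborel S (\<lambda>x. ?I x * (g x $ i - g' x $ i)) = 0"
      by (simp add: set_lebesgue_integral_def)
  qed
  have "AE x in lborel. \<forall>n::nat. \<forall>i. indicator (box (\<chi> k. - real n) (\<chi> k. real n)) x * (g x $ i - g' x $ i) = 0"
    unfolding AE_all_countable AE_finite_all[OF finite] using zero by blast
  then show ?thesis
  proof eventually_elim
    case (elim x)
    obtain n :: nat where n: "norm x < n" using reals_Archimedean2 by blast
    have "\<bar>x$i\<bar> < n" for i using n component_le_norm_cart[of x i] by linarith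
    then have "x \<in> box (\<chi> k. - real n) (\<chi> k. real n)"
      by (simp add: mem_box_cart abs_less_iff minus_less_iff)
    with elim have "g x $ i = g' x $ i" for i
      by (metis indicator_simps(1) mult_1 right_minus_eq)
    then show ?case by (simp add: vec_eq_iff)
  qed
qed

section \<open>The distributional derivative of the crack-tip\<close>

definition pt :: "real \<Rightarrow> real \<Rightarrow> plane" where
  "pt x y = x *\<^sub>R axis 1 1 + y *\<^sub>R axis 2 1"

lemma pt_nth[simp]: "pt x y $ 1 = x" "pt x y $ 2 = y"
  by (simp_all add: pt_def axis_def)

lemma borel_measurable_pt[measurable (raw)]:
  "f \<in> borel_measurable M \<Longrightarrow> g \<in> borel_measurable M \<Longrightarrow> (\<lambda>x. pt (f x) (g x)) \<in> borel_measurable M"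
  unfolding pt_def by (intro borel_measurable_add borel_measurable_scaleR borel_measurable_const)

lemma norm_pt: "norm (pt x y) = sqrt (x\<^sup>2 + y\<^sup>2)"
  by (simp only: norm_plane pt_nth)

text \<open>Lebesgue measure is characterised by its values on boxes; this turns integrals over the
  plane into integrals over a product, to which Fubini applies.\<close>

lemma lborel_plane: "(lborel :: plane measure) = distr (lborel \<Otimes>\<^sub>M lborel) borel (\<lambda>(x, y). pt x y)"
proof (rule lborel_eqI)
  fix l u :: plane assume le: "\<And>b. b \<in> Basis \<Longrightarrow> l \<bullet> b \<le> u \<bullet> b"
  have lu: "l $ 1 \<le> u $ 1" "l $ 2 \<le> u $ 2"
    using le[of "axis 1 1"] le[of "axis 2 1"] by (auto simp: inner_axis axis_in_Basis_iff)
  have v: "(\<lambda>(x, y). pt x y) -` box l u = {l$1<..<u$1} \<times> {l$2<..<u$2}"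
    by (auto simp: mem_box_cart forall_2)
  have "emeasure (distr (lborel \<Otimes>\<^sub>M lborel) borel (\<lambda>(x, y). pt x y)) (box l u) =
      emeasure (lborel \<Otimes>\<^sub>M lborel) ({l$1<..<u$1} \<times> {l$2<..<u$2})"
    by (subst emeasure_distr) (auto simp: v space_pair_measure)
  also have "\<dots> = ennreal ((u$1 - l$1) * (u$2 - l$2))"
    using lu by (simp add: lborel.emeasure_pair_measure_Times ennreal_mult)
  also have "(u$1 - l$1) * (u$2 - l$2) = (\<Prod>b\<in>Basis. (u - l) \<bullet> b)"
    by (simp add: Basis_vec_def UNIV_2 axis_eq_axis inner_axis)
  finally show "emeasure (distr (lborel \<Otimes>\<^sub>M lborel) borel (\<lambda>(x, y). pt x y)) (box l u) =
      ennreal (\<Prod>b\<in>Basis. (u - l) \<bullet> b)" .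
qed simp

lemma integrable_plane_slices:
  fixes f :: "plane \<Rightarrow> real"
  assumes f: "integrable lborel f"
  shows "AE x in lborel. integrable lborel (\<lambda>y. f (pt x y))"
    "AE y in lborel. integrable lborel (\<lambda>x. f (pt x y))"
    "(\<integral>p. f p \<partial>lborel) = (\<integral>x. (\<integral>y. f (pt x y) \<partial>lborel) \<partial>lborel)"
    "(\<integral>p. f p \<partial>lborel) = (\<integral>y. (\<integral>x. f (pt x y) \<partial>lborel) \<partial>lborel)"
proof -
  have [measurable]: "f \<in> borel_measurable borel" using f by auto
  have i: "integrable (lborel \<Otimes>\<^sub>M lborel) (\<lambda>(x, y). f (pt x y))"
    using f by (subst (asm) lborel_plane) (simp add: integrable_distr_eq split_beta')
  have e: "(\<integral>p. f p \<partial>lborel) = (\<integral>p. (case p of (x, y) \<Rightarrow> f (pt x y)) \<partial>(lborel \<Otimes>\<^sub>M lborel))"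
    by (subst lborel_plane) (simp add: integral_distr split_beta')
  show "AE x in lborel. integrable lborel (\<lambda>y. f (pt x y))"
    using lborel_pair.AE_integrable_fst'[OF i] by simp
  show "AE y in lborel. integrable lborel (\<lambda>x. f (pt x y))"
    using lborel_pair.AE_integrable_snd[OF i] by simp
  show "(\<integral>p. f p \<partial>lborel) = (\<integral>x. (\<integral>y. f (pt x y) \<partial>lborel) \<partial>lborel)"
    using lborel_pair.integral_fst'[OF i] e by simp
  show "(\<integral>p. f p \<partial>lborel) = (\<integral>y. (\<integral>x. f (pt x y) \<partial>lborel) \<partial>lborel)"
    using lborel_pair.integral_snd[OF i] e by simp
qed

text \<open>In polar coordinates this is (2 pi \<rho>)^(-1/2) (cos (\<phi>/2), sin (\<phi>/2)), the
  pointwise gradient of \<open>tip\<close> off the horizontal axis.\<close>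

definition tip_grad :: "plane \<Rightarrow> plane" where
  "tip_grad p = pt (sgn (p$2) * sqrt (norm p + p$1) / (2 * sqrt pi * norm p))
    (sqrt (norm p - p$1) / (2 * sqrt pi * norm p))"

lemma tip_grad_nth:
  "tip_grad p $ 1 = sgn (p$2) * sqrt (norm p + p$1) / (2 * sqrt pi * norm p)"
  "tip_grad p $ 2 = sqrt (norm p - p$1) / (2 * sqrt pi * norm p)"
  by (simp_all only: tip_grad_def pt_nth)

lemma borel_measurable_tip_grad[measurable]: "tip_grad \<in> borel_measurable borel"
  unfolding tip_grad_def[abs_def] by measurable

lemma borel_measurable_tip[measurable]: "tip \<in> borel_measurable borel"
  unfolding tip_def[abs_def] by measurable

lemma norm_minus_component_nonneg: "0 \<le> norm x - x$1" for x :: plane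
  using component_le_norm_cart[of x 1] by linarith

lemma norm_tip_grad_square:
  assumes "p$2 \<noteq> 0"
  shows "(norm (tip_grad p))\<^sup>2 = 1 / (2 * pi * norm p)"
proof -
  have n: "norm p \<noteq> 0" using assms by auto
  have "(norm (tip_grad p))\<^sup>2 = (tip_grad p $ 1)\<^sup>2 + (tip_grad p $ 2)\<^sup>2"
    by (simp add: norm_plane[of "tip_grad p"])
  also have "\<dots> = (norm p + p$1) / (4 * pi * (norm p)\<^sup>2) + (norm p - p$1) / (4 * pi * (norm p)\<^sup>2)"
    using assms norm_plus_component_nonneg[of p] norm_minus_component_nonneg[of p]
    by (simp add: tip_grad_nth power_divide power_mult_distrib)
       (simp add: sgn_real_def)
  also have "\<dots> = 1 / (2 * pi * norm p)"
    using n by (simp add: field_simps power2_eq_square)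
  finally show ?thesis .
qed

lemma AE_off_axis: "AE p::plane in lborel. p$2 \<noteq> 0"
  using AE_not_in[OF null_axis] by simp

text \<open>Integrability follows from finite energy: \<bar>g\<bar> \<le> 1 + \<bar>g\<bar>^2, and
  the integral of the square over a disc about the tip is already known.\<close>

lemma integrable_tip_grad_ball:
  "integrable lborel (\<lambda>p. indicator (ball 0 R) p *\<^sub>R tip_grad p)"
proof (cases "R > 0")
  case True
  have [measurable]: "ball (0::plane) R \<in> sets borel" by simp
  have "integrable lborel (\<lambda>p::plane. indicator (ball 0 R) p * (1 / (2 * pi * norm p)))"
  proof (rule integrableI_bounded)
    have "(\<integral>\<^sup>+p. ennreal (norm (indicator (ball 0 R) p * (1 / (2 * pi * norm p)))) \<partial>(lborel::plane measure))
      = emeasure tip_energy (ball 0 R)"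
      by (subst emeasure_tip_energy) (auto simp: indicator_def intro!: nn_integral_cong)
    then show "(\<integral>\<^sup>+p. ennreal (norm (indicator (ball 0 R) p * (1 / (2 * pi * norm p)))) \<partial>(lborel::plane measure)) < \<infinity>"
      using True by (simp add: emeasure_tip_energy_ball)
  qed measurable
  moreover have "integrable lborel (indicator (ball 0 R) :: plane \<Rightarrow> real)"
    using emeasure_bounded_finite[of "ball (0::plane) R"] by (simp add: integrable_indicator_iff)
  ultimately have "integrable lborel (\<lambda>p::plane. indicator (ball 0 R) p + indicator (ball 0 R) p * (1 / (2 * pi * norm p)))"
    by (intro Bochner_Integration.integrable_add)
  then show ?thesis
  proof (rule Bochner_Integration.integrable_bound)
    show "AE p in lborel. norm (indicator (ball 0 R) p *\<^sub>R tip_grad p) \<le>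
      norm (indicator (ball 0 R) p + indicator (ball 0 R) p * (1 / (2 * pi * norm p)))"
      using AE_off_axis
    proof eventually_elim
      case (elim p)
      have "2 * norm (tip_grad p) \<le> 1 + (norm (tip_grad p))\<^sup>2"
        using sum_squares_bound[of 1 "norm (tip_grad p)"] by simp
      then have "norm (tip_grad p) \<le> 1 + 1 / (2 * pi * norm p)"
        using elim by (simp add: norm_tip_grad_square) (smt (verit) norm_ge_zero)
      then show ?case by (auto simp: indicator_def)
    qed
  qed measurable
next
  case False
  then have "ball (0::plane) R = {}" by simp
  then show ?thesis by (simp only: indicator_simps(2) empty_iff simp_thms scaleR_zero_left) simp
qed

lemma locally_integrable_tip_grad: "locally_integrable UNIV tip_grad"
  unfolding locally_integrable_def
proof (intro allI impI)
  fix K :: "plane set" assume K: "compact K \<and> K \<subseteq> UNIV"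
  then obtain R where "K \<subseteq> ball 0 R" using bounded_subset_ballD[OF compact_imp_bounded, of K 0] by blast
  moreover have "K \<in> sets borel" using K by (simp add: borel_compact)
  moreover have "set_integrable lborel (ball 0 R) tip_grad"
    using integrable_tip_grad_ball by (simp add: set_integrable_def)
  ultimately have "set_integrable lborel K tip_grad"
    using set_integrable_subset by (metis sets_lborel)
  then show "set_integrable lebesgue K tip_grad"
    using \<open>K \<in> sets borel\<close> by (simp add: set_integrable_def integrable_completion)
qed

text \<open>On a horizontal line off the axis \<open>sgn y\<close> is constant, and
  \<open>s > \<bar>x\<bar>\<close> keeps the argument of the root positive, so the chain rule
  applies.\<close>

lemma tip_has_real_derivative_1:
  assumes "y \<noteq> 0"
  shows "((\<lambda>x. tip (pt x y)) has_real_derivative tip_grad (pt x y) $ 1) (at x)"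
proof -
  define s where "s = norm (pt x y)"
  have s: "s > 0" "s = sqrt (x\<^sup>2 + y\<^sup>2)" "s + x > 0"
  proof -
    show s: "s = sqrt (x\<^sup>2 + y\<^sup>2)" by (simp only: s_def norm_pt)
    have "x\<^sup>2 + y\<^sup>2 > \<bar>x\<bar>\<^sup>2" using assms by simp
    then have "s > \<bar>x\<bar>" unfolding s by (rule real_less_rsqrt)
    then show "s > 0" "s + x > 0" by linarith+
  qed
  have pos: "x\<^sup>2 + y\<^sup>2 > 0" "(sqrt (x\<^sup>2 + y\<^sup>2) + x) / pi > 0"
    using assms s by (simp_all add: sum_power2_gt_zero_iff)
  have r: "((\<lambda>x. sqrt (x\<^sup>2 + y\<^sup>2)) has_real_derivative x / s) (at x)"
    using pos(1) by (auto intro!: derivative_eq_intros simp: s(2) field_simps)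
  have "((\<lambda>x. sgn y * sqrt ((sqrt (x\<^sup>2 + y\<^sup>2) + x) / pi)) has_real_derivative
      sgn y * (inverse (sqrt ((s + x) / pi)) / 2 * ((x / s + 1) / pi))) (at x)"
    using DERIV_cmult[OF DERIV_chain2[OF DERIV_real_sqrt[OF pos(2)] DERIV_cdivide[OF DERIV_add[OF r DERIV_ident]]], of "sgn y"]
    by (simp only: s(2))
  also have "sgn y * (inverse (sqrt ((s + x) / pi)) / 2 * ((x / s + 1) / pi)) = sgn y * sqrt (s + x) / (2 * sqrt pi * s)"
  proof -
    \<comment> \<open>With the roots \<open>sqrt (s + x)\<close> and \<open>sqrt pi\<close>
      abstracted as \<open>a\<close> and \<open>b\<close>, the simplification is an identity of
      rational functions.\<close>
    have "inverse (a / b) / 2 * (a * a / s / (b * b)) = a / (2 * b * s)" if "a > 0" "b > 0" for a b :: real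
      using that s(1) by (simp add: field_simps)
    from this[of "sqrt (s + x)" "sqrt pi"]
    have "inverse (sqrt ((s + x) / pi)) / 2 * ((s + x) / s / pi) = sqrt (s + x) / (2 * sqrt pi * s)"
      using s by (simp add: real_sqrt_divide)
    moreover have "x / s + 1 = (s + x) / s" using s(1) by (simp add: field_simps)
    ultimately show ?thesis by (simp only: times_divide_eq_right[symmetric])
  qed
  finally show ?thesis
    unfolding tip_def tip_grad_nth pt_nth norm_pt s(2) .
qed

text \<open>The factorisation y^2 = (s + x)(s - x) turns the quotient \<bar>y\<bar> / sqrt(s + x)
  into sqrt(s - x). The sign is frozen as a constant \<open>c\<close> for the differentiation and
  restored on the half-line where it agrees with \<open>sgn\<close>.\<close>

lemma tip_has_real_derivative_2:
  assumes "y \<noteq> 0"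
  shows "((\<lambda>y. tip (pt x y)) has_real_derivative tip_grad (pt x y) $ 2) (at y)"
proof -
  define s where "s = norm (pt x y)"
  have s: "s > 0" "s = sqrt (x\<^sup>2 + y\<^sup>2)" "s + x > 0" "s - x > 0"
  proof -
    show s: "s = sqrt (x\<^sup>2 + y\<^sup>2)" by (simp only: s_def norm_pt)
    have "x\<^sup>2 + y\<^sup>2 > \<bar>x\<bar>\<^sup>2" using assms by simp
    then have "s > \<bar>x\<bar>" unfolding s by (rule real_less_rsqrt)
    then show "s > 0" "s + x > 0" "s - x > 0" by linarith+
  qed
  have "y\<^sup>2 = (s + x) * (s - x)" using s(1,2) by (simp add: algebra_simps flip: power2_eq_square)
  then have y: "\<bar>y\<bar> = sqrt (s + x) * sqrt (s - x)" by (metis real_sqrt_abs real_sqrt_mult)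
  define c where "c = sgn y"
  have pos: "x\<^sup>2 + y\<^sup>2 > 0" "(sqrt (x\<^sup>2 + y\<^sup>2) + x) / pi > 0"
    using assms s by (simp_all add: sum_power2_gt_zero_iff)
  have r: "((\<lambda>y. sqrt (x\<^sup>2 + y\<^sup>2)) has_real_derivative y / s) (at y)"
    using pos(1) by (auto intro!: derivative_eq_intros simp: s(2) field_simps)
  have "((\<lambda>y. c * sqrt ((sqrt (x\<^sup>2 + y\<^sup>2) + x) / pi)) has_real_derivative
      c * (inverse (sqrt ((s + x) / pi)) / 2 * ((y / s + 0) / pi))) (at y)"
    using DERIV_cmult[OF DERIV_chain2[OF DERIV_real_sqrt[OF pos(2)] DERIV_cdivide[OF DERIV_add[OF r DERIV_const]]], of c]
    by (simp only: s(2))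
  also have "c * (inverse (sqrt ((s + x) / pi)) / 2 * ((y / s + 0) / pi))
    = \<bar>y\<bar> / (s * sqrt pi * sqrt pi * 2) * (sqrt pi / sqrt (s + x))"
    by (simp add: c_def real_sqrt_divide abs_sgn field_simps)
  also have "\<dots> = sqrt (s - x) / (2 * sqrt pi * s)"
    unfolding y using s by (simp add: field_simps)
  finally have D: "((\<lambda>y. c * sqrt ((sqrt (x\<^sup>2 + y\<^sup>2) + x) / pi)) has_real_derivative
      sqrt (s - x) / (2 * sqrt pi * s)) (at y)" .
  have "((\<lambda>y. sgn y * sqrt ((sqrt (x\<^sup>2 + y\<^sup>2) + x) / pi)) has_real_derivative
      sqrt (s - x) / (2 * sqrt pi * s)) (at y)"
    by (rule has_field_derivative_transform_within_open[OF D, of "if y > 0 then {0<..} else {..<0}"])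
       (use assms in \<open>auto simp: c_def split: if_splits\<close>)
  then show ?thesis
    unfolding tip_def tip_grad_nth pt_nth norm_pt s(2) .
qed

section \<open>Test functions along coordinate lines\<close>

lemma has_real_derivative_partial_deriv:
  assumes "\<phi> differentiable (at (pt x y))"
  shows "((\<lambda>x. \<phi> (pt x y)) has_real_derivative partial_deriv 1 \<phi> (pt x y)) (at x)"
    "((\<lambda>y. \<phi> (pt x y)) has_real_derivative partial_deriv 2 \<phi> (pt x y)) (at y)"
proof -
  have D: "(\<phi> has_derivative frechet_derivative \<phi> (at (pt x y))) (at (pt x y))"
    using assms by (simp add: frechet_derivative_works)
  have s: "(\<lambda>h. frechet_derivative \<phi> (at (pt x y)) (h *\<^sub>R axis i 1)) = (*) (partial_deriv i \<phi> (pt x y))" for i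
    using linear_scale[OF has_derivative_linear[OF D]] by (auto simp: partial_deriv_def mult.commute)
  have "((\<lambda>x. pt x y) has_derivative (\<lambda>h. h *\<^sub>R axis 1 1)) (at x)"
    "((\<lambda>y. pt x y) has_derivative (\<lambda>h. h *\<^sub>R axis 2 1)) (at y)"
    unfolding pt_def by (auto intro!: derivative_eq_intros)
  from this[THEN has_derivative_compose, OF D]
  show "((\<lambda>x. \<phi> (pt x y)) has_real_derivative partial_deriv 1 \<phi> (pt x y)) (at x)"
    "((\<lambda>y. \<phi> (pt x y)) has_real_derivative partial_deriv 2 \<phi> (pt x y)) (at y)"
    unfolding has_field_derivative_def s by simp_all
qed

text \<open>One radius and one bound serve the function and both partial derivatives; the complement
  of the closed support is open, so the derivatives vanish there too.\<close>

lemma test_function_bounds: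
  assumes \<phi>: "\<phi> \<in> C1_compact_support UNIV"
  obtains R B where "R > 0" "\<And>p. R \<le> norm p \<Longrightarrow> \<phi> p = 0" "\<And>i p. R \<le> norm p \<Longrightarrow> partial_deriv i \<phi> p = 0"
    "\<And>p. \<bar>\<phi> p\<bar> \<le> B" "\<And>i p. \<bar>partial_deriv i \<phi> p\<bar> \<le> B"
proof -
  let ?S = "closure {x. \<phi> x \<noteq> 0}"
  have d: "\<And>x. \<phi> differentiable (at x)" and c: "\<And>i. continuous_on UNIV (partial_deriv i \<phi>)" and K: "compact ?S"
    using \<phi> by (auto simp: C1_compact_support_def)
  obtain R where R: "R > 0" "?S \<subseteq> ball 0 R"
    using bounded_subset_ballD[OF compact_imp_bounded[OF K]] by blast
  have cont: "continuous_on UNIV \<phi>" by (rule test_function_continuous[OF \<phi>])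
  have z: "\<phi> p = 0" if "R \<le> norm p" for p
    using that R(2) closure_subset[of "{x. \<phi> x \<noteq> 0}"] by (force simp: subset_iff)
  have z': "partial_deriv i \<phi> p = 0" if "R \<le> norm p" for p i
  proof -
    have p: "p \<in> - ?S" using that R(2) by auto
    have "((\<lambda>x. 0) has_derivative (\<lambda>x. 0)) (at p)" by simp
    then have "(\<phi> has_derivative (\<lambda>x. 0)) (at p)"
      by (rule has_derivative_transform_within_open[OF _ _ p])
         (use closure_subset[of "{x. \<phi> x \<noteq> 0}"] in auto)
    then show ?thesis by (simp add: partial_deriv_def frechet_derivative_at[symmetric])
  qed
  have bd: "\<exists>B. \<forall>p. \<bar>f p\<bar> \<le> B" if "continuous_on UNIV f" "\<And>p. R \<le> norm p \<Longrightarrow> f p = 0" for f :: "plane \<Rightarrow> real"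
  proof -
    have "compact (f ` cball 0 R)"
      using that(1) continuous_on_subset by (intro compact_continuous_image) auto
    then obtain B where B: "\<forall>p\<in>cball 0 R. \<bar>f p\<bar> \<le> B"
      using compact_imp_bounded[of "f ` cball 0 R"] by (auto simp: bounded_iff)
    have "\<bar>f p\<bar> \<le> max B 0" for p
    proof (cases "R \<le> norm p")
      case False
      then have "\<bar>f p\<bar> \<le> B" using B by simp
      then show ?thesis by simp
    qed (simp add: that(2))
    then show ?thesis by blast
  qed
  obtain B0 B1 B2 where "\<And>p. \<bar>\<phi> p\<bar> \<le> B0" "\<And>p. \<bar>partial_deriv 1 \<phi> p\<bar> \<le> B1" "\<And>p. \<bar>partial_deriv 2 \<phi> p\<bar> \<le> B2"
    using bd[OF cont z] bd[OF c z', of 1] bd[OF c z', of 2] by blast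
  note b = this
  let ?B = "max B0 (max B1 B2)"
  have b0: "\<bar>\<phi> p\<bar> \<le> ?B" for p using b(1)[of p] by simp
  have "\<bar>partial_deriv i \<phi> p\<bar> \<le> ?B" for i p
    using exhaust_2[of i] b(2)[of p] b(3)[of p] by (auto simp: le_max_iff_disj)
  from that[OF R(1) z z' b0 this] show thesis .
qed

section \<open>Integration by parts across the crack\<close>

lemma integral_eq_has_integral:
  fixes f :: "real \<Rightarrow> real"
  assumes f: "integrable lborel f" and I: "(f has_integral I) {a..b}" and z: "\<And>x. x \<notin> {a..b} \<Longrightarrow> f x = 0"
  shows "(\<integral>x. f x \<partial>lborel) = I"
proof -
  have "(f has_integral I) UNIV"
    by (rule has_integral_on_superset[OF I]) (use z in auto)
  then show ?thesis using has_integral_integral_lborel[OF f] has_integral_unique by blast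
qed

text \<open>The upper trace minus the lower trace at (t, 0). It vanishes for t \<le> 0, so integrals
  over the crack can be written over the whole axis.\<close>

definition trace_jump :: "real \<Rightarrow> real" where
  "trace_jump t = 2 * sqrt ((\<bar>t\<bar> + t) / pi)"

text \<open>The fundamental theorem of calculus is applied to the product with \<phi> on almost
  every coordinate line. Horizontal lines off the axis avoid the crack and leave no boundary term;
  vertical lines may cross it and pick up the jump of the traces.\<close>

lemma tip_by_parts:
  assumes \<phi>: "\<phi> \<in> C1_compact_support UNIV"
  shows "integrable lborel (\<lambda>p. tip p * partial_deriv i \<phi> p)" (is ?A)
    "integrable lborel (\<lambda>p. \<phi> p * tip_grad p $ i)" (is ?B)
    "(\<integral>p. tip p * partial_deriv 1 \<phi> p + \<phi> p * tip_grad p $ 1 \<partial>lborel) = 0" (is ?C)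
    "(\<integral>p. tip p * partial_deriv 2 \<phi> p + \<phi> p * tip_grad p $ 2 \<partial>lborel) = - (\<integral>t. trace_jump t * \<phi> (pt t 0) \<partial>lborel)" (is ?D)
proof -
  obtain R B where R: "R > 0" "\<And>p. R \<le> norm p \<Longrightarrow> \<phi> p = 0" "\<And>i p. R \<le> norm p \<Longrightarrow> partial_deriv i \<phi> p = 0"
    and B: "\<And>p. \<bar>\<phi> p\<bar> \<le> B" "\<And>i p. \<bar>partial_deriv i \<phi> p\<bar> \<le> B"
    using test_function_bounds[OF \<phi>] by metis
  have B0: "B \<ge> 0" using B(1)[of 0] by linarith
  have d: "\<And>x. \<phi> differentiable (at x)" and c: "\<And>i. continuous_on UNIV (partial_deriv i \<phi>)"
    using \<phi> by (auto simp: C1_compact_support_def)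
  have cont: "continuous_on UNIV \<phi>" by (rule test_function_continuous[OF \<phi>])
  have [measurable]: "\<phi> \<in> borel_measurable borel" "partial_deriv i \<phi> \<in> borel_measurable borel" for i
    using cont c by (auto intro: borel_measurable_continuous_onI)
  have [measurable]: "ball (0::plane) R \<in> sets borel" by simp
  have tipb: "\<bar>tip p\<bar> \<le> sqrt (2 * R / pi)" if "norm p < R" for p
  proof -
    have "norm p + p$1 \<le> 2 * R" using component_le_norm_cart[of p 1] that by linarith
    then have "sqrt ((norm p + p$1) / pi) \<le> sqrt (2 * R / pi)" by (simp add: divide_right_mono)
    then show ?thesis
      using norm_plus_component_nonneg[of p] R(1) by (simp add: tip_def abs_mult abs_sgn_eq)
  qed
  have A: "integrable lborel (\<lambda>p. tip p * partial_deriv i \<phi> p)" for i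
  proof (rule Bochner_Integration.integrable_bound)
    show "integrable lborel (\<lambda>p::plane. sqrt (2 * R / pi) * B * indicator (ball 0 R) p)"
      using emeasure_bounded_finite[of "ball (0::plane) R"]
      by (intro integrable_mult_right) (simp add: integrable_indicator_iff)
    show "AE p in lborel. norm (tip p * partial_deriv i \<phi> p) \<le> norm (sqrt (2 * R / pi) * B * indicator (ball 0 R) p)"
    proof (intro AE_I2)
      fix p
      show "norm (tip p * partial_deriv i \<phi> p) \<le> norm (sqrt (2 * R / pi) * B * indicator (ball 0 R) p)"
        using tipb[of p] B(2)[of i p] R(1) R(3)[of p i] B0
        by (cases "norm p < R") (auto simp: abs_mult intro!: mult_mono)
    qed
  qed measurable
  then show ?A .
  have A': "integrable lborel (\<lambda>p. \<phi> p * tip_grad p $ i)" for i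
  proof (rule Bochner_Integration.integrable_bound)
    show "integrable lborel (\<lambda>p. B *\<^sub>R (indicator (ball 0 R) p *\<^sub>R tip_grad p))"
      by (intro integrable_scaleR_right integrable_tip_grad_ball)
    show "AE p in lborel. norm (\<phi> p * tip_grad p $ i) \<le> norm (B *\<^sub>R (indicator (ball 0 R) p *\<^sub>R tip_grad p))"
    proof (intro AE_I2)
      fix p
      show "norm (\<phi> p * tip_grad p $ i) \<le> norm (B *\<^sub>R (indicator (ball 0 R) p *\<^sub>R tip_grad p))"
        using B(1)[of p] R(2)[of p] B0 component_le_norm_cart[of "tip_grad p" i]
        by (cases "norm p < R") (auto simp: abs_mult intro!: mult_mono)
    qed
  qed measurable
  then show ?B .
  let ?f = "\<lambda>i p. tip p * partial_deriv i \<phi> p + \<phi> p * tip_grad p $ i"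
  have fi: "integrable lborel (?f i)" for i using A A' by (intro Bochner_Integration.integrable_add)
  have fm[measurable]: "?f i \<in> borel_measurable borel" for i by measurable
  have f0: "?f i p = 0" if "R \<le> norm p" for i p using R(2,3) that by simp
  have n: "\<bar>x\<bar> \<le> norm (pt x y)" "\<bar>y\<bar> \<le> norm (pt x y)" for x y
    using component_le_norm_cart[of "pt x y" 1] component_le_norm_cart[of "pt x y" 2] by simp_all
  show ?C
  proof -
    \<comment> \<open>The line y = 0, the only one containing the crack, is a single value of y and
      hence negligible.\<close>
    have sl: "(\<integral>x. ?f 1 (pt x y) \<partial>lborel) = 0" if y: "y \<noteq> 0" and int: "integrable lborel (\<lambda>x. ?f 1 (pt x y))" for y
    proof (rule integral_eq_has_integral[OF int])
      let ?w = "\<lambda>x. tip (pt x y) * \<phi> (pt x y)"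
      have w: "(?w has_real_derivative ?f 1 (pt x y)) (at x)" for x
        using DERIV_mult[OF tip_has_real_derivative_1[OF y] has_real_derivative_partial_deriv(1)[OF d]]
        by (simp add: algebra_simps)
      have "((\<lambda>x. ?f 1 (pt x y)) has_integral ?w R - ?w (- R)) {- R..R}"
        using R(1) w by (intro fundamental_theorem_of_calculus)
          (auto simp: has_real_derivative_iff_has_vector_derivative intro: has_vector_derivative_at_within)
      moreover have "?w R = 0" "?w (- R) = 0" using R(1,2) n(1)[of R y] n(1)[of "-R" y] by auto
      ultimately show "((\<lambda>x. ?f 1 (pt x y)) has_integral 0) {- R..R}" by simp
      show "?f 1 (pt x y) = 0" if "x \<notin> {-R..R}" for x
        using that n(1)[of x y] by (intro f0) auto
    qed
    have "AE y in lborel. (\<integral>x. ?f 1 (pt x y) \<partial>lborel) = 0"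
      using integrable_plane_slices(2)[OF fi[of 1]] AE_lborel_singleton[of 0]
      by eventually_elim (rule sl)
    then have "(\<integral>y. (\<integral>x. ?f 1 (pt x y) \<partial>lborel) \<partial>lborel) = (\<integral>y. 0 \<partial>(lborel :: real measure))"
      by (intro integral_cong_AE) simp_all
    then show ?thesis using integrable_plane_slices(4)[OF fi[of 1]] by simp
  qed
  show ?D
  proof -
    have sl: "(\<integral>y. ?f 2 (pt x y) \<partial>lborel) = - (trace_jump x * \<phi> (pt x 0))"
      if int: "integrable lborel (\<lambda>y. ?f 2 (pt x y))" for x
    proof (rule integral_eq_has_integral[OF int])
      define k where "k y = sqrt ((norm (pt x y) + x) / pi) * \<phi> (pt x y)" for y
      \<comment> \<open>Subtracting the two traces on the axis makes the slice continuous, so that the fundamental theorem applies across the cut.\<close>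
      define w where "w y = sgn y * (k y - k 0)" for y
      have w: "w y = tip (pt x y) * \<phi> (pt x y) - sgn y * k 0" for y
        by (simp add: w_def k_def tip_def algebra_simps)
      have "continuous_on UNIV (\<lambda>y. pt x y)" unfolding pt_def by (intro continuous_intros)
      then have kc: "continuous_on UNIV k"
        unfolding k_def by (intro continuous_intros continuous_on_compose2[OF cont]) auto
      have dw: "(w has_real_derivative ?f 2 (pt x y)) (at y)" if y: "y \<noteq> 0" for y
      proof -
        have "((\<lambda>t. tip (pt x t) * \<phi> (pt x t) - sgn y * k 0) has_real_derivative ?f 2 (pt x y)) (at y)"
          using DERIV_diff[OF DERIV_mult[OF tip_has_real_derivative_2[OF y] has_real_derivative_partial_deriv(2)[OF d]] DERIV_const]
          by (simp add: algebra_simps)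
        then show ?thesis
          by (rule has_field_derivative_transform_within_open[of _ _ _ "if y > 0 then {0<..} else {..<0}"])
             (use y in \<open>auto simp: w split: if_splits\<close>)
      qed
      have "isCont w y" for y
      proof (cases "y = 0")
        case True
        have "(k \<longlongrightarrow> k 0) (at 0)"
          using kc by (simp add: continuous_on_eq_continuous_at isCont_def)
        then have "((\<lambda>y. k y - k 0) \<longlongrightarrow> 0) (at 0)" by (simp add: LIM_zero)
        then have "(w \<longlongrightarrow> 0) (at 0)"
          by (rule Lim_null_comparison[rotated, OF tendsto_rabs_zero])
             (auto simp: w_def abs_mult abs_sgn_eq intro!: always_eventually)
        moreover have "w 0 = 0" by (simp add: w_def)
        ultimately show ?thesis using True by (simp add: isCont_def)
      next
        case False
        then show ?thesis using dw DERIV_isCont by blast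
      qed
      \<comment> \<open>The derivative formula may fail at the crossing point 0; continuity there
        suffices for this version of the theorem.\<close>
      then have "((\<lambda>y. ?f 2 (pt x y)) has_integral w R - w (- R)) {- R..R}"
        using R(1) dw by (intro fundamental_theorem_of_calculus_strong[of "{0}"])
          (auto simp: has_real_derivative_iff_has_vector_derivative continuous_at_imp_continuous_on)
      \<comment> \<open>Beyond the support only the subtracted constant survives:
        \<open>w R = - k 0\<close> and \<open>w (- R) = k 0\<close>, whence the total
        \<open>- 2 * k 0\<close>.\<close>
      moreover have "k R = 0" "k (- R) = 0" using R(1,2) n(2)[of R x] n(2)[of "-R" x] by (auto simp: k_def)
      moreover have "trace_jump x * \<phi> (pt x 0) = 2 * k 0"
        by (simp add: trace_jump_def k_def norm_pt)
      ultimately show "((\<lambda>y. ?f 2 (pt x y)) has_integral - (trace_jump x * \<phi> (pt x 0))) {- R..R}"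
        using R(1) by (simp add: w_def)
      show "?f 2 (pt x y) = 0" if "y \<notin> {-R..R}" for y
        using that n(2)[of y x] by (intro f0) auto
    qed
    have "AE x in lborel. (\<integral>y. ?f 2 (pt x y) \<partial>lborel) = - (trace_jump x * \<phi> (pt x 0))"
      using integrable_plane_slices(1)[OF fi[of 2]] by eventually_elim (rule sl)
    then have "(\<integral>x. (\<integral>y. ?f 2 (pt x y) \<partial>lborel) \<partial>lborel) = (\<integral>x. - (trace_jump x * \<phi> (pt x 0)) \<partial>lborel)"
      by (intro integral_cong_AE) (simp_all add: trace_jump_def)
    then show ?thesis using integrable_plane_slices(3)[OF fi[of 2]] by simp
  qed
qed

text \<open>The total variation of the jump part, that is, the size of the jump times length along
  the crack, realised as the image of a weighted Lebesgue measure on the line.\<close>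

definition jump_measure :: "plane measure" where
  "jump_measure = distr (density lborel (\<lambda>t. ennreal (trace_jump t))) borel (\<lambda>t. pt t 0)"

lemma trace_jump_nonneg: "0 \<le> trace_jump t"
  by (simp add: trace_jump_def)

lemma borel_measurable_trace_jump[measurable]: "trace_jump \<in> borel_measurable borel"
  unfolding trace_jump_def[abs_def] by measurable

lemma emeasure_jump_measure_finite:
  assumes "compact K"
  shows "emeasure jump_measure K < \<infinity>"
proof -
  have [measurable]: "K \<in> sets borel" using assms by (rule borel_compact)
  obtain R where R: "K \<subseteq> ball 0 R" using bounded_subset_ballD[OF compact_imp_bounded[OF assms]] by blast
  have sub: "\<bar>t\<bar> \<le> \<bar>R\<bar>" if "pt t 0 \<in> K" for t
    using subsetD[OF R that] by (simp add: norm_pt)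
  have "emeasure jump_measure K = (\<integral>\<^sup>+t. ennreal (trace_jump t) * indicator ((\<lambda>t. pt t 0) -` K) t \<partial>lborel)"
  proof -
    have "(\<lambda>t. pt t 0) -` K \<in> sets borel" by (rule measurable_sets_borel[where M = borel]) measurable
    then show ?thesis
      unfolding jump_measure_def by (subst emeasure_distr) (auto simp: emeasure_density)
  qed
  also have "\<dots> \<le> (\<integral>\<^sup>+t. ennreal (2 * sqrt (2 * \<bar>R\<bar> / pi)) * indicator {-\<bar>R\<bar>..\<bar>R\<bar>} t \<partial>lborel)"
  proof (intro nn_integral_mono)
    fix t
    show "ennreal (trace_jump t) * indicator ((\<lambda>t. pt t 0) -` K) t \<le>
        ennreal (2 * sqrt (2 * \<bar>R\<bar> / pi)) * indicator {-\<bar>R\<bar>..\<bar>R\<bar>} t"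
    proof (cases "pt t 0 \<in> K")
      case True
      then have t: "\<bar>t\<bar> \<le> \<bar>R\<bar>" by (rule sub)
      then have "trace_jump t \<le> 2 * sqrt (2 * \<bar>R\<bar> / pi)"
        by (auto simp: trace_jump_def intro!: divide_right_mono)
      moreover have "t \<in> {-\<bar>R\<bar>..\<bar>R\<bar>}" using t by auto
      ultimately show ?thesis using True by (simp add: ennreal_leI)
    qed simp
  qed
  also have "\<dots> < \<infinity>" by (simp add: nn_integral_cmult_indicator ennreal_mult_less_top)
  finally show ?thesis .
qed

lemma integral_jump_measure:
  assumes [measurable]: "f \<in> borel_measurable borel"
  shows "(\<integral>p. f p \<partial>jump_measure) = (\<integral>t. trace_jump t * (f (pt t 0) :: real) \<partial>lborel)"
  unfolding jump_measure_def
  by (subst integral_distr) (auto simp: integral_real_density trace_jump_nonneg)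

text \<open>Nothing is prescribed for the crack-tip on the half-line, so \<open>u\<close> need not
  be Borel; completeness of Lebesgue measure makes it measurable all the same.\<close>

lemma borel_measurable_lebesgue_AE:
  fixes f h :: "'a::euclidean_space \<Rightarrow> 'b::topological_space"
  assumes h: "h \<in> borel_measurable borel" and ae: "AE x in lborel. f x = h x"
  shows "f \<in> borel_measurable lebesgue"
proof (rule measurableI)
  fix S :: "'b set" assume S: "S \<in> sets borel"
  have "h -` S \<in> sets lebesgue"
    using measurable_sets_borel[OF h S] by simp
  moreover have "AE x in lebesgue. x \<in> h -` S \<longleftrightarrow> x \<in> f -` S"
    using ae by (rule AE_completion[THEN eventually_mono]) auto
  ultimately have "f -` S \<in> sets lebesgue"
    by (intro completion.in_sets_AE[of "h -` S" "f -` S"]) auto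
  then show "f -` S \<inter> space lebesgue \<in> sets lebesgue" by simp
qed simp

text \<open>The jump is counted from below to above, which makes the density nonnegative and the
  unit direction the upward normal \<open>axis 2 1\<close>.\<close>

lemma crack_tip_decomposition:
  assumes u: "crack_tip u"
  shows "derivative_decomposition UNIV u tip_grad (\<lambda>_. axis 2 1) jump_measure"
  unfolding derivative_decomposition_def
proof (intro conjI ballI allI impI)
  show "\<exists>N\<in>null_sets lborel. AE x in jump_measure. x \<in> UNIV \<inter> N"
  proof (intro bexI[OF _ null_axis])
    have "{x \<in> space borel. x \<in> UNIV \<inter> {x::plane. x$2 = 0}} \<in> sets borel" by measurable
    then show "AE x in jump_measure. x \<in> UNIV \<inter> {x. x$2 = 0}"
      unfolding jump_measure_def by (subst AE_distr_iff) auto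
  qed
  show "emeasure jump_measure K < \<infinity>" if "compact K \<and> K \<subseteq> UNIV" for K
    using that emeasure_jump_measure_finite by blast
  fix \<phi> i assume \<phi>: "\<phi> \<in> C1_compact_support UNIV"
  have [measurable]: "\<phi> \<in> borel_measurable borel" "partial_deriv i \<phi> \<in> borel_measurable borel"
    using test_function_continuous[OF \<phi>] by (auto intro: borel_measurable_continuous_onI)
  have ae: "AE x in lborel. u x = tip x"
    using AE_off_axis by eventually_elim (auto simp: slit_def intro!: crack_tip_eq_tip[OF u])
  have um: "u \<in> borel_measurable lebesgue"
    by (rule borel_measurable_lebesgue_AE[OF borel_measurable_tip ae])
  have "(\<integral>x. u x * partial_deriv i \<phi> x \<partial>lebesgue) = (\<integral>x. tip x * partial_deriv i \<phi> x \<partial>lebesgue)"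
  proof (rule integral_cong_AE)
    have [measurable]: "partial_deriv i \<phi> \<in> borel_measurable lebesgue" "tip \<in> borel_measurable lebesgue"
      by (auto intro: measurable_completion)
    note um[measurable]
    show "(\<lambda>x. u x * partial_deriv i \<phi> x) \<in> borel_measurable lebesgue"
      "(\<lambda>x. tip x * partial_deriv i \<phi> x) \<in> borel_measurable lebesgue" by measurable
    show "AE x in lebesgue. u x * partial_deriv i \<phi> x = tip x * partial_deriv i \<phi> x"
      by (rule AE_completion[OF eventually_mono[OF ae]]) simp
  qed
  also have "\<dots> = (\<integral>x. tip x * partial_deriv i \<phi> x \<partial>lborel)" by (simp add: integral_completion)
  also have "\<dots> = (\<integral>x. tip x * partial_deriv i \<phi> x + \<phi> x * tip_grad x $ i \<partial>lborel) - (\<integral>x. \<phi> x * tip_grad x $ i \<partial>lborel)"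
    using tip_by_parts(1,2)[OF \<phi>] by simp
  \<comment> \<open>For \<open>i = 1\<close> the component of the normal is 0, matching the absence
    of a boundary term on horizontal lines.\<close>
  also have "(\<integral>x. tip x * partial_deriv i \<phi> x + \<phi> x * tip_grad x $ i \<partial>lborel) =
      - (\<integral>x. \<phi> x * axis 2 1 $ i \<partial>jump_measure)"
    using exhaust_2[of i] tip_by_parts(3,4)[OF \<phi>]
    by (auto simp: axis_def integral_jump_measure)
  finally show "(\<integral>x. u x * partial_deriv i \<phi> x \<partial>lebesgue) =
      - (\<integral>x. \<phi> x * tip_grad x $ i \<partial>lebesgue) - (\<integral>x. \<phi> x * axis 2 1 $ i \<partial>jump_measure)"
    by (simp add: integral_completion)
qed (auto simp: locally_integrable_tip_grad jump_measure_def[THEN arg_cong[of _ _ sets]])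

text \<open>Existence of a decomposition makes the choice in \<open>ac_gradient\<close> a genuine
  one, and uniqueness identifies it with \<open>tip_grad\<close> almost everywhere. The jump set
  lies in the null axis, so removing it does not change the integral.\<close>

lemma dirichlet_energy_crack_tip:
  assumes u: "crack_tip u" and A: "A \<in> sets borel"
  shows "dirichlet_energy UNIV u A = emeasure tip_energy A"
proof -
  obtain \<sigma> \<mu> where "derivative_decomposition UNIV u (ac_gradient UNIV u) \<sigma> \<mu>"
    using someI[of "\<lambda>g. \<exists>\<sigma> \<mu>. derivative_decomposition UNIV u g \<sigma> \<mu>"] crack_tip_decomposition[OF u]
    unfolding ac_gradient_def by blast
  from derivative_decomposition_unique[OF this crack_tip_decomposition[OF u]]
  have "AE x in lborel. ennreal ((norm (ac_gradient UNIV u x))\<^sup>2) * indicator (A - jump_set u) x =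
      ennreal (1 / (2 * pi * norm x)) * indicator A x"
    using AE_off_axis
  proof eventually_elim
    case (elim x)
    then have "x \<notin> jump_set u" using jump_set_crack_tip_subset[OF u] by (auto simp: slit_def)
    then show ?case using elim by (simp add: norm_tip_grad_square indicator_def)
  qed
  then have "dirichlet_energy UNIV u A = (\<integral>\<^sup>+x\<in>A. ennreal (1 / (2 * pi * norm x)) \<partial>lebesgue)"
    unfolding dirichlet_energy_def by (intro nn_integral_cong_AE AE_completion)
  also have "\<dots> = emeasure tip_energy A"
    using A by (simp add: emeasure_tip_energy nn_integral_completion)
  finally show ?thesis .
qed

section \<open>Failure of monotonicity\<close>

theorem mainTheorem4:
  fixes u :: "real^2 \<Rightarrow> real" and e1 :: "real^2"
  assumes "crack_tip u" and "e1 = vector [1, 0]"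
  shows "(\<forall>a::real. a > 3/2 \<longrightarrow> \<not> mono_on {0<..} (\<lambda>r. min (F UNIV u r e1) (ennreal a))) \<and>
         (MS_minimizer UNIV u \<longrightarrow>
           (\<forall>a::real. a > 3/2 \<longrightarrow>
             \<not> (\<forall>\<Omega> v x0. MS_minimizer \<Omega> v \<and> x0 \<in> \<Omega> \<longrightarrow>
                  mono_on (radii \<Omega> x0) (\<lambda>r. min (F \<Omega> v r x0) (ennreal a)))))"
proof (rule conjI)
  have e1: "e1 = axis 1 1" using assms(2) by (simp add: vec_eq_iff forall_2 axis_def)
  have F: "F UNIV u r e1 = (emeasure tip_energy (ball e1 r) + ennreal ((1 + r) / 2)) / ennreal r"
    if "r \<ge> 1" for r
  proof -
    have h: "ennreal (1 + r) / 2 = ennreal ((1 + r) / 2)"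
      using that divide_ennreal[of "1 + r" 2] by simp
    show ?thesis
      by (simp only: F_def assms(2) hausdorff1_jump_set[OF assms(1) that]
          dirichlet_energy_crack_tip[OF assms(1)] borel_open open_ball h)
  qed
  have lower: "ennreal (3/2) < F UNIV u 100 e1"
  proof -
    \<comment> \<open>The upper bound excludes the value \<open>top\<close>, so the computation can
      be done in the reals.\<close>
    obtain k where k: "emeasure tip_energy (ball e1 100) = ennreal k" "k \<ge> 0"
      using emeasure_tip_energy_ball_e1_le[of 100] unfolding e1
      by (cases "emeasure tip_energy (ball (axis 1 1) 100)") (auto simp: top_unique)
    \<comment> \<open>This is the threshold r - 1/2 at r = 100.\<close>
    have "199/2 < k" using emeasure_tip_energy_ball_e1_gt k unfolding e1 by (simp add: ennreal_less_iff)
    have "F UNIV u 100 e1 = ennreal ((k + (1 + 100) / 2) / 100)"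
      using k(2) by (subst F, simp, subst k(1), subst ennreal_plus[symmetric], simp, simp, subst divide_ennreal) auto
    then show ?thesis using \<open>199/2 < k\<close> by (simp only:) (intro ennreal_lessI; simp)
  qed
  have upper: "F UNIV u r e1 \<le> ennreal (3/2 * (1 + 1 / r))" if "r \<ge> 1" for r
  proof -
    have "F UNIV u r e1 \<le> (ennreal (r + 1) + ennreal ((1 + r) / 2)) / ennreal r"
      using that emeasure_tip_energy_ball_e1_le[of r] unfolding F[OF that, unfolded e1] e1
      by (intro divide_right_mono_ennreal add_mono) auto
    also have "\<dots> = ennreal (3/2 * (1 + 1 / r))"
      using that by (simp add: divide_ennreal field_simps flip: ennreal_plus)
    finally show ?thesis .
  qed
  show main: "\<forall>a::real. a > 3/2 \<longrightarrow> \<not> mono_on {0<..} (\<lambda>r. min (F UNIV u r e1) (ennreal a))"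
  proof (intro allI impI notI)
    fix a :: real assume a: "a > 3/2" and mono: "mono_on {0<..} (\<lambda>r. min (F UNIV u r e1) (ennreal a))"
    \<comment> \<open>The truncated value at 100 still exceeds 3/2. A level \<open>m\<close>
      strictly between the two lies below \<open>a\<close>, so once \<open>F\<close> falls to
      \<open>m\<close> the truncation cannot hide the drop.\<close>
    have "ennreal (3/2) < min (F UNIV u 100 e1) (ennreal a)" using lower a by (simp add: ennreal_lessI)
    then obtain l where l: "ennreal (3/2) < l" "l < min (F UNIV u 100 e1) (ennreal a)" using dense by blast
    have "l < top" using l(2) by (metis ennreal_less_top min_less_iff_conj order.strict_trans)
    then obtain m where m: "l = ennreal m" "m \<ge> 0" by (cases l) auto
    then have m32: "m > 3/2" using l(1) by (simp add: ennreal_less_iff)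
    \<comment> \<open>The second entry solves 3/2 (1 + 1/r) = m; the first keeps \<open>r\<close> to
      the right of the reference radius.\<close>
    define r where "r = max 100 (3 / (2 * m - 3))"
    have r: "r \<ge> 100" "3 / (2 * m - 3) \<le> r" by (simp_all add: r_def)
    then have "3/2 * (1 + 1 / r) \<le> m" using m32 by (simp add: field_simps)
    then have "F UNIV u r e1 \<le> l" using upper[of r] r(1) unfolding m(1) by (meson ennreal_leI order_trans one_le_numeral)
    moreover have "min (F UNIV u 100 e1) (ennreal a) \<le> min (F UNIV u r e1) (ennreal a)"
      using r(1) by (intro mono_onD[OF mono]) auto
    ultimately show False using l(2) by (meson leD min.cobounded1 order_trans)
  qed
  show "MS_minimizer UNIV u \<longrightarrow> (\<forall>a::real. a > 3/2 \<longrightarrow>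
      \<not> (\<forall>\<Omega> v x0. MS_minimizer \<Omega> v \<and> x0 \<in> \<Omega> \<longrightarrow>
        mono_on (radii \<Omega> x0) (\<lambda>r. min (F \<Omega> v r x0) (ennreal a))))"
  proof (intro impI allI notI)
    fix a :: real
    assume "MS_minimizer UNIV u" "a > 3/2" and all: "\<forall>\<Omega> v x0. MS_minimizer \<Omega> v \<and> x0 \<in> \<Omega> \<longrightarrow>
        mono_on (radii \<Omega> x0) (\<lambda>r. min (F \<Omega> v r x0) (ennreal a))"
    then have "mono_on (radii UNIV e1) (\<lambda>r. min (F UNIV u r e1) (ennreal a))" by blast
    \<comment> \<open>The whole plane has empty frontier, so the infimum of distances is infinite
      and every positive radius is admissible.\<close>
    moreover have "radii UNIV e1 = {0<..}" by (auto simp: radii_def top_ereal_def)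
    ultimately show False using main \<open>a > 3/2\<close> by simp
  qed
qed

end
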